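(* Let $\Delta$ be a twin building of type $(W,S)$ having at least one non-exotic rank $2$ residue, and let $J\subseteq S$ be nonempty. Then no automorphism $\theta$ of $\Delta$ maps every $S\setminus J$-residue to an opposite residue.
   Context: $(W,S)$ is a Coxeter system with $S$ finite and $W$ irreducible. A twin building consists of two buildings $\Delta^+,\Delta^-$ of type $(W,S)$ with a codistance $\delta^*$ satisfying the usual twin building axioms. A $K$-residue of $\Delta^\epsilon$ is a set $\{D\in\Delta^\epsilon:\delta(C,D)\in W_K\}$; a rank $2$ residue is a $K$-residue with $|K|=2$. Chambers in different halves are opposite if $\delta^*(C,D)=1$; residues $P,Q$ in different halves are opposite if every chamber of $P$ is opposite some chamber of $Q$. An automorphism is a bijection of chambers preserving adjacency and opposition (not necessarily type preserving). A rank $2$ building (generalised polygon) is non-exotic if it is thick, finite, and has parameters $(s,t)$ with $\gcd(s,t)>1$, where parameters $(s,t)$ means every panel of one type contains exactly $s+1$ chambers and every panel of the other type exactly $t+1$ chambers.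
   Formalization: A non-exotic rank 2 residue is required to be a generalised n-gon with n ≥ 3; generalised digons are excluded, since with them the claim fails (e.g. the Chevalley involution of a split Kac–Moody twin building over F_q, q ≡ 3 mod 4, with even Cartan entries and a digon residue). *)

theory Defs
  imports "HOL-Algebra.Multiplicative_Group" "HOL-Algebra.Generated_Groups"
begin

section \<open>Coxeter systems\<close>

definition word_prod :: "('w, 'z) monoid_scheme \<Rightarrow> 'w list \<Rightarrow> 'w" where
  "word_prod W us = foldr (\<lambda>x y. x \<otimes>\<^bsub>W\<^esub> y) us \<one>\<^bsub>W\<^esub>"

text \<open>The entry \<open>m(s,t)\<close> of the Coxeter matrix is the order of \<open>s t\<close>. The library function
  \<^const>\<open>group.ord\<close> yields \<open>0\<close> for elements of infinite order, so \<open>m(s,t) = 0\<close> encodes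
  \<open>m(s,t) = \<infinity>\<close>.\<close>

definition cox_m :: "('w, 'z) monoid_scheme \<Rightarrow> 'w \<Rightarrow> 'w \<Rightarrow> nat" where
  "cox_m W s t = group.ord W (s \<otimes>\<^bsub>W\<^esub> t)"

text \<open>Insertion of a relator \<open>(s t)\<^bsup>m(s,t)\<^esup>\<close> into a word over \<open>S\<close>. For \<open>s = t\<close> the relator is
  \<open>s s\<close>; for \<open>m(s,t) = \<infinity>\<close> it is the empty word. As the relators \<open>s s\<close> make all generators
  invertible, words over \<open>S\<close> without formal inverses suffice for a group presentation.\<close>

inductive cox_insert ::
  "('w, 'z) monoid_scheme \<Rightarrow> 'w set \<Rightarrow> 'w list \<Rightarrow> 'w list \<Rightarrow> bool" for W S where
  "\<lbrakk>us \<in> lists S; vs \<in> lists S; s \<in> S; t \<in> S\<rbrakk> \<Longrightarrow>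
     cox_insert W S (us @ vs) (us @ concat (replicate (cox_m W s t) [s, t]) @ vs)"

text \<open>The last assumption says that \<open>\<langle>S | (s t)\<^bsup>m(s,t)\<^esup> = 1\<rangle>\<close> is a presentation of \<open>W\<close>.\<close>

locale coxeter_system = group W for W (structure) +
  fixes S
  assumes S_subset: "S \<subseteq> carrier W"
    and S_generates: "generate W S = carrier W"
    and S_involution: "s \<in> S \<Longrightarrow> s \<noteq> \<one> \<and> s \<otimes> s = \<one>"
    and presentation:
      "\<lbrakk>us \<in> lists S; vs \<in> lists S; word_prod W us = word_prod W vs\<rbrakk> \<Longrightarrow>
         equivclp (cox_insert W S) us vs"

definition irreducible_coxeter :: "('w, 'z) monoid_scheme \<Rightarrow> 'w set \<Rightarrow> bool" where
  "irreducible_coxeter W S \<longleftrightarrow>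
     \<not> (\<exists>I K. I \<noteq> {} \<and> K \<noteq> {} \<and> I \<union> K = S \<and> I \<inter> K = {} \<and>
           (\<forall>s\<in>I. \<forall>t\<in>K. cox_m W s t = 2))"

definition word_length :: "('w, 'z) monoid_scheme \<Rightarrow> 'w set \<Rightarrow> 'w \<Rightarrow> nat" where
  "word_length W S w = (LEAST n. \<exists>us\<in>lists S. length us = n \<and> word_prod W us = w)"

section \<open>Buildings and twin buildings\<close>

locale building = coxeter_system W S for W (structure) and S +
  fixes Ch :: "'c set" and \<delta> :: "'c \<Rightarrow> 'c \<Rightarrow> 'a"
  assumes nonempty: "Ch \<noteq> {}"
    and \<delta>_closed: "\<lbrakk>C \<in> Ch; D \<in> Ch\<rbrakk> \<Longrightarrow> \<delta> C D \<in> carrier W"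
    and WD1: "\<lbrakk>C \<in> Ch; D \<in> Ch\<rbrakk> \<Longrightarrow> \<delta> C D = \<one> \<longleftrightarrow> C = D"
    and WD2: "\<lbrakk>C \<in> Ch; C' \<in> Ch; D \<in> Ch; s \<in> S; \<delta> C' C = s; \<delta> C D = w\<rbrakk> \<Longrightarrow>
        \<delta> C' D \<in> {s \<otimes> w, w} \<and>
        (word_length W S (s \<otimes> w) = word_length W S w + 1 \<longrightarrow> \<delta> C' D = s \<otimes> w)"
    and WD3: "\<lbrakk>C \<in> Ch; D \<in> Ch; s \<in> S; \<delta> C D = w\<rbrakk> \<Longrightarrow>
        \<exists>C'\<in>Ch. \<delta> C' C = s \<and> \<delta> C' D = s \<otimes> w"

datatype sign = Pos | Neg

fun opp_sign :: "sign \<Rightarrow> sign" where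
  "opp_sign Pos = Neg"
| "opp_sign Neg = Pos"

text \<open>Both halves live, as disjoint sets, in one type of chambers; \<open>\<delta>\<close> is only meaningful for
  two chambers of the same half and \<open>cod\<close> (the codistance) for chambers of different halves.\<close>

locale twin_building = coxeter_system W S for W (structure) and S +
  fixes Ch :: "sign \<Rightarrow> 'c set" and \<delta> cod :: "'c \<Rightarrow> 'c \<Rightarrow> 'a"
  assumes halves: "building W S (Ch \<epsilon>) \<delta>"
    and disjoint: "Ch Pos \<inter> Ch Neg = {}"
    and cod_closed: "\<lbrakk>C \<in> Ch \<epsilon>; D \<in> Ch (opp_sign \<epsilon>)\<rbrakk> \<Longrightarrow> cod C D \<in> carrier W"
    and Tw1: "\<lbrakk>C \<in> Ch \<epsilon>; D \<in> Ch (opp_sign \<epsilon>)\<rbrakk> \<Longrightarrow> cod C D = inv (cod D C)"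
    and Tw2: "\<lbrakk>C \<in> Ch \<epsilon>; C' \<in> Ch \<epsilon>; D \<in> Ch (opp_sign \<epsilon>); cod C D = w; s \<in> S; \<delta> C' C = s;
        word_length W S (s \<otimes> w) < word_length W S w\<rbrakk> \<Longrightarrow> cod C' D = s \<otimes> w"
    and Tw3: "\<lbrakk>C \<in> Ch \<epsilon>; D \<in> Ch (opp_sign \<epsilon>); cod C D = w; s \<in> S\<rbrakk> \<Longrightarrow>
        \<exists>C'\<in>Ch \<epsilon>. \<delta> C' C = s \<and> cod C' D = s \<otimes> w"

section \<open>Residues, opposition, automorphisms\<close>

definition residue_of ::
  "('w, 'z) monoid_scheme \<Rightarrow> 'c set \<Rightarrow> ('c \<Rightarrow> 'c \<Rightarrow> 'w) \<Rightarrow> 'w set \<Rightarrow> 'c \<Rightarrow> 'c set" where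
  "residue_of W Y \<delta> K C = {D \<in> Y. \<delta> C D \<in> generate W K}"

definition residues_of_type ::
  "('w, 'z) monoid_scheme \<Rightarrow> 'c set \<Rightarrow> ('c \<Rightarrow> 'c \<Rightarrow> 'w) \<Rightarrow> 'w set \<Rightarrow> 'c set set" where
  "residues_of_type W Y \<delta> K = residue_of W Y \<delta> K ` Y"

definition opposite ::
  "('w, 'z) monoid_scheme \<Rightarrow> (sign \<Rightarrow> 'c set) \<Rightarrow> ('c \<Rightarrow> 'c \<Rightarrow> 'w) \<Rightarrow> 'c \<Rightarrow> 'c \<Rightarrow> bool" where
  "opposite W Ch cod C D \<longleftrightarrow>
     (\<exists>\<epsilon>. C \<in> Ch \<epsilon> \<and> D \<in> Ch (opp_sign \<epsilon>) \<and> cod C D = \<one>\<^bsub>W\<^esub>)"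

definition opposite_residues ::
  "('w, 'z) monoid_scheme \<Rightarrow> 'w set \<Rightarrow> (sign \<Rightarrow> 'c set) \<Rightarrow> ('c \<Rightarrow> 'c \<Rightarrow> 'w) \<Rightarrow>
   ('c \<Rightarrow> 'c \<Rightarrow> 'w) \<Rightarrow> 'c set \<Rightarrow> 'c set \<Rightarrow> bool" where
  "opposite_residues W S Ch \<delta> cod P Q \<longleftrightarrow>
     (\<exists>\<epsilon> K L. K \<subseteq> S \<and> L \<subseteq> S \<and>
        P \<in> residues_of_type W (Ch \<epsilon>) \<delta> K \<and> Q \<in> residues_of_type W (Ch (opp_sign \<epsilon>)) \<delta> L) \<and>
     (\<forall>C\<in>P. \<exists>D\<in>Q. opposite W Ch cod C D)"

definition adjacent ::
  "'w set \<Rightarrow> (sign \<Rightarrow> 'c set) \<Rightarrow> ('c \<Rightarrow> 'c \<Rightarrow> 'w) \<Rightarrow> 'c \<Rightarrow> 'c \<Rightarrow> bool" where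
  "adjacent S Ch \<delta> C D \<longleftrightarrow> (\<exists>\<epsilon>. C \<in> Ch \<epsilon> \<and> D \<in> Ch \<epsilon> \<and> \<delta> C D \<in> S)"

definition twin_automorphism ::
  "('w, 'z) monoid_scheme \<Rightarrow> 'w set \<Rightarrow> (sign \<Rightarrow> 'c set) \<Rightarrow> ('c \<Rightarrow> 'c \<Rightarrow> 'w) \<Rightarrow>
   ('c \<Rightarrow> 'c \<Rightarrow> 'w) \<Rightarrow> ('c \<Rightarrow> 'c) \<Rightarrow> bool" where
  "twin_automorphism W S Ch \<delta> cod \<theta> \<longleftrightarrow>
     bij_betw \<theta> (Ch Pos \<union> Ch Neg) (Ch Pos \<union> Ch Neg) \<and>
     (\<forall>C \<in> Ch Pos \<union> Ch Neg. \<forall>D \<in> Ch Pos \<union> Ch Neg.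
        (adjacent S Ch \<delta> (\<theta> C) (\<theta> D) \<longleftrightarrow> adjacent S Ch \<delta> C D) \<and>
        (opposite W Ch cod (\<theta> C) (\<theta> D) \<longleftrightarrow> opposite W Ch cod C D))"

section \<open>Non-exotic generalised polygons\<close>

text \<open>A rank \<open>2\<close> building \<open>Y\<close> of type \<open>{a, b}\<close> is a generalised \<open>m(a,b)\<close>-gon. As usual, generalised
  polygons are generalised \<open>n\<close>-gons with \<open>n \<ge> 3\<close>: generalised digons (\<open>n = 2\<close>, complete
  bipartite graphs) are not polygons. The case \<open>m(a,b) = \<infinity>\<close> is irrelevant here, as such a
  building is never both finite and thick.\<close>

definition has_parameters ::
  "('w, 'z) monoid_scheme \<Rightarrow> 'c set \<Rightarrow> ('c \<Rightarrow> 'c \<Rightarrow> 'w) \<Rightarrow> 'w \<Rightarrow> 'w \<Rightarrow> nat \<Rightarrow> nat \<Rightarrow> bool" where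
  "has_parameters W Y \<delta> a b s t \<longleftrightarrow>
     (\<forall>P \<in> residues_of_type W Y \<delta> {a}. card P = s + 1) \<and>
     (\<forall>P \<in> residues_of_type W Y \<delta> {b}. card P = t + 1)"

definition thick ::
  "('w, 'z) monoid_scheme \<Rightarrow> 'w set \<Rightarrow> 'c set \<Rightarrow> ('c \<Rightarrow> 'c \<Rightarrow> 'w) \<Rightarrow> bool" where
  "thick W K Y \<delta> \<longleftrightarrow> (\<forall>a\<in>K. \<forall>P \<in> residues_of_type W Y \<delta> {a}. infinite P \<or> card P \<ge> 3)"

definition non_exotic ::
  "('w, 'z) monoid_scheme \<Rightarrow> 'w set \<Rightarrow> 'c set \<Rightarrow> ('c \<Rightarrow> 'c \<Rightarrow> 'w) \<Rightarrow> bool" where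
  "non_exotic W K Y \<delta> \<longleftrightarrow>
     thick W K Y \<delta> \<and> finite Y \<and>
     (\<exists>a b s t. K = {a, b} \<and> a \<noteq> b \<and> cox_m W a b \<ge> 3 \<and>
        has_parameters W Y \<delta> a b s t \<and> gcd s t > 1)"

end

theory Submission
  imports Defs "HOL-Computational_Algebra.Primes" "HOL-Number_Theory.Cong" "HOL-Library.Sublist"
begin

text \<open>
  If \<open>\<theta>\<close> maps every \<open>S - J\<close>-residue to an opposite one, all displacements
  \<open>\<delta>\<^sup>*(C, \<theta> C)\<close> lie in the proper parabolic subgroup generated by \<open>S - J\<close>. Comparing the
  displacements of adjacent chambers shows that whenever they lie in \<open>W\<^sub>K\<close> with \<open>K\<close> proper, they
  commute with every \<open>s \<notin> K\<close>; irreducibility then forces all displacements to be trivial, and \<open>\<theta>\<close>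
  preserves types.

  On a finite residue \<open>R\<close> of type \<open>{a, b}\<close>, composing \<open>\<theta>\<close> with the projection to \<open>R\<close> gives a
  permutation of \<open>R\<close> moving every chamber to an opposite one. Let \<open>p\<close> be a prime dividing both
  parameters. Modulo \<open>p\<close> the panel-sum operators generate a \<open>0\<close>-Hecke algebra, so the sum over a
  long alternating gallery type is the all-one operator, whose trace \<open>|R|\<close> is \<open>1\<close>. A short product
  of panel sums, twisted by the permutation, has a power equal to that operator, so its trace is \<open>1\<close>
  as well: some chamber is mapped to a chamber at short distance. The trace is compared with that of
  the \<open>p\<^sup>r\<close>-th power by rotating closed walks.
\<close>

section \<open>The exchange condition\<close>

text \<open>A common prime divisor of both parameters gives panels of both types size 1 modulo the
  same \<open>p\<close>. Panel sums are then idempotent modulo \<open>p\<close>, and a product of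
  them depends only on which elements are values of subwords. The contradiction rests on one
  element: the permutation displaces every chamber of \<open>R\<close> by the longest element of the
  finite dihedral group, whereas the trace forces some displacement to be the value of a subword of
  \<open>[a, b]\<close>; for \<open>m(a,b) \<ge> 3\<close> the longest element is no such value. Two
  features shape the bookkeeping. The permutation acts on types by conjugation with the longest
  element and may exchange \<open>a\<close> and \<open>b\<close>, so moving it past a panel sum can
  change the type. And \<open>\<theta>\<close> is not assumed to preserve types, so the type of the
  image of an \<open>S - J\<close>-residue has to be identified before displacements can be confined
  to a parabolic subgroup.\<close>

context coxeter_system
begin

abbreviation wp :: "'a list \<Rightarrow> 'a" where "wp \<equiv> word_prod W"
abbreviation len :: "'a \<Rightarrow> nat" where "len \<equiv> word_length W S"

lemma S_carrier [simp]: "s \<in> S \<Longrightarrow> s \<in> carrier W"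
  using S_subset by blast

lemma S_square [simp]: "s \<in> S \<Longrightarrow> s \<otimes> s = \<one>"
  using S_involution by blast

lemma S_inv [simp]: "s \<in> S \<Longrightarrow> inv s = s"
  by (simp add: inv_equality)

lemma S_cancel [simp]: "\<lbrakk>s \<in> S; w \<in> carrier W\<rbrakk> \<Longrightarrow> s \<otimes> (s \<otimes> w) = w"
  by (simp flip: m_assoc)

lemma wp_Nil [simp]: "wp [] = \<one>"
  by (simp add: word_prod_def)

lemma wp_Cons [simp]: "wp (s # us) = s \<otimes> wp us"
  by (simp add: word_prod_def)

lemma wp_closed [simp]: "set us \<subseteq> S \<Longrightarrow> wp us \<in> carrier W"
  by (induction us) auto

lemma wp_append: "\<lbrakk>set us \<subseteq> S; set vs \<subseteq> S\<rbrakk> \<Longrightarrow> wp (us @ vs) = wp us \<otimes> wp vs"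
  by (induction us) (auto simp: m_assoc)

lemma wp_rev: "set us \<subseteq> S \<Longrightarrow> wp (rev us) = inv (wp us)"
  by (induction us) (auto simp: wp_append inv_mult_group)

lemma generate_eq_words:
  assumes "K \<subseteq> S"
  shows "generate W K = wp ` {us. set us \<subseteq> K}"
proof
  show "generate W K \<subseteq> wp ` {us. set us \<subseteq> K}"
  proof
    fix w assume "w \<in> generate W K"
    then show "w \<in> wp ` {us. set us \<subseteq> K}"
    proof induction
      case one
      show ?case by (rule image_eqI[of _ _ "[]"]) auto
    next
      case (incl h)
      with assms show ?case by (intro image_eqI[of _ _ "[h]"]) auto
    next
      case (inv h)
      moreover from this assms have "inv h = h" by auto
      ultimately show ?case using assms by (intro image_eqI[of _ _ "[h]"]) auto
    next
      case (eng h1 h2)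
      then obtain us vs where "set us \<subseteq> K" "h1 = wp us" "set vs \<subseteq> K" "h2 = wp vs" by auto
      moreover from this assms have "set us \<subseteq> S" "set vs \<subseteq> S" by auto
      ultimately show ?case by (intro image_eqI[of _ _ "us @ vs"]) (auto simp: wp_append)
    qed
  qed
  have "wp us \<in> generate W K" if "set us \<subseteq> K" for us
    using that by (induction us) (simp_all add: generate.one generate.incl generate.eng)
  then show "wp ` {us. set us \<subseteq> K} \<subseteq> generate W K" by auto
qed

lemma len_le: "set us \<subseteq> S \<Longrightarrow> len (wp us) \<le> length us"
  unfolding word_length_def by (rule Least_le) auto

lemma reduced_word_exists:
  assumes "w \<in> carrier W"
  obtains us where "set us \<subseteq> S" "wp us = w" "length us = len w"
proof -
  obtain vs where "set vs \<subseteq> S" "wp vs = w"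
    using assms generate_eq_words[of S] S_generates by auto
  then have "\<exists>n. \<exists>us\<in>lists S. length us = n \<and> wp us = w" by (auto simp: lists_eq_set)
  then have "\<exists>us\<in>lists S. length us = len w \<and> wp us = w"
    unfolding word_length_def by (rule LeastI_ex)
  then show thesis using that by (auto simp: lists_eq_set)
qed

text \<open>The reflections attached to the prefixes of a word: letter \<open>s\<^sub>i\<close> contributes
  \<open>s\<^sub>1 \<cdots> s\<^sub>i\<^sub>-\<^sub>1 s\<^sub>i s\<^sub>i\<^sub>-\<^sub>1 \<cdots> s\<^sub>1\<close>. The parity with which a given element occurs among them depends only on the
  value of the word.\<close>

primrec refls :: "'a list \<Rightarrow> 'a list" where
  "refls [] = []"
| "refls (s # us) = s # map (\<lambda>t. s \<otimes> t \<otimes> s) (refls us)"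

lemma refls_carrier: "set us \<subseteq> S \<Longrightarrow> set (refls us) \<subseteq> carrier W"
  by (induction us) auto

lemma refls_append:
  assumes "set us \<subseteq> S" "set vs \<subseteq> S"
  shows "refls (us @ vs) = refls us @ map (\<lambda>t. wp us \<otimes> t \<otimes> inv (wp us)) (refls vs)"
  using assms
proof (induction us)
  case Nil
  then show ?case using refls_carrier[of vs] by (auto intro!: map_idI[symmetric])
next
  case (Cons s us)
  then show ?case using refls_carrier[of vs]
    by (auto simp: inv_mult_group m_assoc)
qed

lemma set_relator: "\<lbrakk>s \<in> S; t \<in> S\<rbrakk> \<Longrightarrow> set (concat (replicate n [s, t])) \<subseteq> S"
  by (induction n) auto

lemma wp_relator: "\<lbrakk>s \<in> S; t \<in> S\<rbrakk> \<Longrightarrow> wp (concat (replicate n [s, t])) = (s \<otimes> t) [^] n"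
proof (induction n)
  case (Suc n)
  then show ?case using nat_pow_Suc2[of "s \<otimes> t" n] by (simp add: m_assoc)
qed simp

lemma refls_relator:
  assumes "s \<in> S" "t \<in> S"
  shows "refls (concat (replicate n [s, t])) = map (\<lambda>i. (s \<otimes> t) [^] i \<otimes> s) [0..<2 * n]"
proof (induction n)
  case (Suc n)
  let ?r = "\<lambda>i::nat. (s \<otimes> t) [^] i \<otimes> s"
  have conj: "s \<otimes> (t \<otimes> ?r i \<otimes> t) \<otimes> s = ?r (Suc (Suc i))" for i
  proof -
    have "?r (Suc (Suc i)) = (s \<otimes> t) \<otimes> (s \<otimes> t) [^] i \<otimes> (s \<otimes> t) \<otimes> s"
      using assms nat_pow_Suc2[of "s \<otimes> t" i] by simp
    then show ?thesis using assms by (simp add: m_assoc)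
  qed
  have "map (\<lambda>i. Suc (Suc i)) [0..<k] = [2..<k + 2]" for k
    by (induction k) auto
  then have "[0..<2 * Suc n] = 0 # 1 # map (\<lambda>i. Suc (Suc i)) [0..<2 * n]"
    by (simp add: upt_conv_Cons numeral_2_eq_2 del: upt_Suc)
  then have "map ?r [0..<2 * Suc n] = ?r 0 # ?r 1 # map (\<lambda>i. ?r (Suc (Suc i))) [0..<2 * n]"
    by (simp only: list.map map_map o_def)
  moreover have "refls (concat (replicate (Suc n) [s, t])) =
      s # s \<otimes> t \<otimes> s # map (\<lambda>i. s \<otimes> (t \<otimes> ?r i \<otimes> t) \<otimes> s) [0..<2 * n]"
    using Suc by (simp add: o_def)
  ultimately show ?case using assms by (simp only: conj) simp
qed simp

text \<open>As \<open>(s t)^m = \<one>\<close>, the \<open>2 m\<close> reflections of the relator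
  are the first \<open>m\<close> listed twice, so each occurs an even number of times; the relator
  has value \<open>\<one>\<close> and leaves the later reflections unchanged. Infinite order,
  encoded as \<open>m = 0\<close>, gives the empty relator.\<close>

lemma cox_insert_invariant:
  assumes "cox_insert W S us vs"
  shows "even (count_list (refls us) r) = even (count_list (refls vs) r)
    \<and> even (length us) = even (length vs)"
  using assms
proof cases
  case (1 xs ys s t)
  define m where "m = cox_m W s t"
  define L where "L = map (\<lambda>i. (s \<otimes> t) [^] i \<otimes> s) [0..<m]"
  let ?rel = "concat (replicate m [s, t])"
  let ?c = "map (\<lambda>t. wp xs \<otimes> t \<otimes> inv (wp xs))"
  have st: "s \<in> S" "t \<in> S" "set xs \<subseteq> S" "set ys \<subseteq> S" using 1 by auto
  have one: "(s \<otimes> t) [^] m = \<one>"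
    using st pow_ord_eq_1 by (simp add: m_def cox_m_def)
  have "[0..<2 * m] = [0..<m] @ map (\<lambda>i. i + m) [0..<m]"
    using upt_add_eq_append[of 0 m m] by (simp add: map_add_upt mult_2)
  moreover have "(s \<otimes> t) [^] (i + m) = (s \<otimes> t) [^] i" for i
    using st one by (simp flip: nat_pow_mult)
  ultimately have rel: "refls ?rel = L @ L"
    using st by (simp add: refls_relator L_def o_def)
  have "map (\<lambda>t. wp ?rel \<otimes> t \<otimes> inv (wp ?rel)) (refls ys) = refls ys"
    using st refls_carrier[of ys] by (intro map_idI) (auto simp: wp_relator one)
  then have "refls (?rel @ ys) = L @ L @ refls ys"
    using st rel set_relator[of s t m] by (simp add: refls_append)
  then have "refls (xs @ ?rel @ ys) = refls xs @ ?c L @ ?c L @ ?c (refls ys)"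
    using st set_relator[of s t m] by (subst refls_append) auto
  moreover have "refls (xs @ ys) = refls xs @ ?c (refls ys)"
    using st by (rule_tac refls_append)
  moreover have "length ?rel = 2 * m" by (induction m) auto
  ultimately show ?thesis using 1 by (simp add: m_def) blast
qed

text \<open>The presentation of \<open>W\<close> enters here: words with the same value are linked
  by insertions and deletions of relators, and both parities survive each of these.\<close>

lemma word_parity:
  assumes "set us \<subseteq> S" "set vs \<subseteq> S" "wp us = wp vs"
  shows "even (count_list (refls us) r) = even (count_list (refls vs) r)"
    and "even (length us) = even (length vs)"
proof -
  have "equivclp (cox_insert W S) us vs"
    using assms by (intro presentation) (auto simp: lists_eq_set)
  then have "even (count_list (refls us) r) = even (count_list (refls vs) r)
      \<and> even (length us) = even (length vs)"
  proof (induction rule: equivclp_induct)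
    case (step y z)
    then show ?case using cox_insert_invariant by metis
  qed simp
  then show "even (count_list (refls us) r) = even (count_list (refls vs) r)"
    and "even (length us) = even (length vs)" by auto
qed

text \<open>A reflection of the word is \<open>u s u^-1\<close>, with \<open>u\<close> the value of
  the prefix before the letter \<open>s\<close>; multiplying by it on the left cancels exactly that
  letter.\<close>

lemma refls_delete:
  assumes "set us \<subseteq> S" "r \<in> set (refls us)"
  shows "\<exists>xs y ys. us = xs @ y # ys \<and> r \<otimes> wp us = wp (xs @ ys)"
  using assms
proof (induction us arbitrary: r)
  case (Cons s us)
  from Cons.prems(2) consider "r = s" | t where "t \<in> set (refls us)" "r = s \<otimes> t \<otimes> s" by auto
  then show ?case
  proof cases
    case 1
    then show ?thesis using Cons.prems by (intro exI[of _ "[]"]) auto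
  next
    case 2
    then obtain xs y ys where xy: "us = xs @ y # ys" "t \<otimes> wp us = wp (xs @ ys)"
      using Cons.IH[of t] Cons.prems by auto
    have "t \<in> carrier W" using 2 refls_carrier[of us] Cons.prems by auto
    then have "r \<otimes> wp (s # us) = s \<otimes> (t \<otimes> wp us)" using 2 Cons.prems by (simp add: m_assoc)
    then have "r \<otimes> wp (s # us) = wp ((s # xs) @ ys)" using xy by simp
    then show ?thesis using xy by (intro exI[of _ "s # xs"] exI[of _ y] exI[of _ ys]) simp
  qed
qed simp

text \<open>The word \<open>us\<close> need not be reduced, since only the parity of the occurrences
  of \<open>s\<close> among the reflections is compared: it is odd for \<open>s # vs\<close> with
  \<open>vs\<close> reduced, hence odd for \<open>us\<close>, and a letter responsible for it can be
  deleted.\<close>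

lemma exchange:
  assumes "s \<in> S" "set us \<subseteq> S" "len (s \<otimes> wp us) < len (wp us)"
  obtains xs y ys where "us = xs @ y # ys" "s \<otimes> wp us = wp (xs @ ys)"
proof -
  obtain vs where vs: "set vs \<subseteq> S" "wp vs = s \<otimes> wp us" "length vs = len (s \<otimes> wp us)"
    using reduced_word_exists[of "s \<otimes> wp us"] assms by auto
  have eq: "wp (s # vs) = wp us" using vs assms by simp
  \<comment> \<open>Otherwise deleting a letter of \<open>vs\<close> would give a word for
    \<open>wp us\<close> shorter than \<open>len (s \<otimes> wp us)\<close>, which is already below
    \<open>len (wp us)\<close>.\<close>
  have "s \<notin> set (refls vs)"
  proof
    assume "s \<in> set (refls vs)"
    then obtain xs y ys where "vs = xs @ y # ys" "s \<otimes> wp vs = wp (xs @ ys)"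
      using refls_delete vs by blast
    then show False using len_le[of "xs @ ys"] vs assms eq by auto
  qed
  then have "s \<notin> set (map (\<lambda>t. s \<otimes> t \<otimes> s) (refls vs))"
  proof (rule contrapos_nn)
    assume "s \<in> set (map (\<lambda>t. s \<otimes> t \<otimes> s) (refls vs))"
    then obtain t where t: "t \<in> set (refls vs)" "s = s \<otimes> t \<otimes> s" by auto
    moreover have "t \<in> carrier W" using t refls_carrier[of vs] vs by auto
    ultimately have "s \<otimes> s \<otimes> s = s \<otimes> (s \<otimes> t \<otimes> s) \<otimes> s" by simp
    then have "t = s" using assms \<open>t \<in> carrier W\<close> by (simp add: m_assoc)
    then show "s \<in> set (refls vs)" using t by simp
  qed
  then have "count_list (refls (s # vs)) s = 1" by simp
  then have "odd (count_list (refls us) s)"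
    using word_parity(1)[of "s # vs" us s] eq vs assms by simp
  then have "s \<in> set (refls us)" by (metis count_notin even_zero)
  then show thesis using refls_delete assms that by blast
qed

section \<open>The length function\<close>

lemma len_mult_neq:
  assumes "s \<in> S" "w \<in> carrier W"
  shows "len (s \<otimes> w) \<noteq> len w"
proof -
  obtain us where us: "set us \<subseteq> S" "wp us = w" "length us = len w"
    using reduced_word_exists assms by blast
  obtain vs where vs: "set vs \<subseteq> S" "wp vs = s \<otimes> w" "length vs = len (s \<otimes> w)"
    using reduced_word_exists[of "s \<otimes> w"] assms by auto
  \<comment> \<open>Relators have even length, so the parity of the length of a word depends only on
    its value, and prefixing \<open>s\<close> flips it.\<close>
  show ?thesis using word_parity(2)[of "s # us" vs] us vs assms by auto
qed

lemma len_mult_le: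
  assumes "v \<in> carrier W" "w \<in> carrier W"
  shows "len (v \<otimes> w) \<le> len v + len w"
proof -
  obtain us where us: "set us \<subseteq> S" "wp us = v" "length us = len v"
    using reduced_word_exists assms by blast
  obtain vs where vs: "set vs \<subseteq> S" "wp vs = w" "length vs = len w"
    using reduced_word_exists assms by blast
  show ?thesis using len_le[of "us @ vs"] us vs by (simp add: wp_append)
qed

lemma len_one [simp]: "len \<one> = 0"
  using len_le[of "[]"] by simp

lemma len_0_iff: "w \<in> carrier W \<Longrightarrow> len w = 0 \<longleftrightarrow> w = \<one>"
  by (metis reduced_word_exists len_one length_0_conv wp_Nil)

lemma len_S [simp]: "s \<in> S \<Longrightarrow> len s = 1"
  using len_le[of "[s]"] len_0_iff[of s] S_involution[of s] by (cases "len s") auto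

lemma len_cases:
  assumes "s \<in> S" "w \<in> carrier W"
  obtains "len (s \<otimes> w) = len w + 1" | "len w = len (s \<otimes> w) + 1"
proof -
  have "len (s \<otimes> w) \<le> len w + 1" "len w \<le> len (s \<otimes> w) + 1"
    using len_mult_le[of s w] len_mult_le[of s "s \<otimes> w"] assms by auto
  then show thesis using len_mult_neq[of s w] assms that by linarith
qed

lemma len_inv:
  assumes "w \<in> carrier W"
  shows "len (inv w) = len w"
proof -
  have "len (inv v) \<le> len v" if "v \<in> carrier W" for v
  proof -
    obtain us where us: "set us \<subseteq> S" "wp us = v" "length us = len v"
      using reduced_word_exists[OF \<open>v \<in> carrier W\<close>] by blast
    show ?thesis using len_le[of "rev us"] us by (simp add: wp_rev)
  qed
  from this[of w] this[of "inv w"] show ?thesis using assms by simp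
qed

end

section \<open>Parabolic subgroups\<close>

lemma append_eq_append_Cons_iff:
  "vs @ ws = xs @ y # ys \<longleftrightarrow>
     (\<exists>zs. vs = xs @ y # zs \<and> ys = zs @ ws) \<or> (\<exists>zs. xs = vs @ zs \<and> ws = zs @ y # ys)"
  by (auto simp: append_eq_append_conv2 append_eq_Cons_conv)

context coxeter_system
begin

lemma generate_carrier: "\<lbrakk>K \<subseteq> S; w \<in> generate W K\<rbrakk> \<Longrightarrow> w \<in> carrier W"
  using generate_in_carrier S_subset by blast

lemma generate_inv: "\<lbrakk>K \<subseteq> S; w \<in> generate W K\<rbrakk> \<Longrightarrow> inv w \<in> generate W K"
  using generate_m_inv_closed[of K w] S_subset by auto

lemma wp_in_generate: "\<lbrakk>K \<subseteq> S; set us \<subseteq> K\<rbrakk> \<Longrightarrow> wp us \<in> generate W K"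
  by (auto simp: generate_eq_words)

lemma generate_cancel_left:
  assumes "K \<subseteq> S" "v \<in> generate W K" "w \<in> carrier W" "v \<otimes> w \<in> generate W K"
  shows "w \<in> generate W K"
proof -
  have "w = inv v \<otimes> (v \<otimes> w)" using assms generate_carrier by (simp flip: m_assoc)
  then show ?thesis using assms generate.eng generate_inv by metis
qed

lemma generate_cancel_right:
  assumes "K \<subseteq> S" "w \<in> generate W K" "v \<in> carrier W" "v \<otimes> w \<in> generate W K"
  shows "v \<in> generate W K"
proof -
  have "v = (v \<otimes> w) \<otimes> inv w" using assms generate_carrier by (simp add: m_assoc)
  then show ?thesis using assms generate.eng generate_inv by metis
qed

text \<open>Exchange only deletes letters, so shortening a word over \<open>K\<close> never leaves
  \<open>K\<close>: lengths in the parabolic subgroup and in \<open>W\<close> agree.\<close>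

lemma reduced_word_in:
  assumes "K \<subseteq> S" "w \<in> generate W K"
  obtains us where "set us \<subseteq> K" "wp us = w" "length us = len w"
proof -
  have "\<exists>vs. set vs \<subseteq> K \<and> wp vs = wp us \<and> length vs = len (wp us)" if "set us \<subseteq> K" for us
    using that
  proof (induction us)
    case Nil
    show ?case by (intro exI[of _ "[]"]) simp
  next
    case (Cons s us)
    then obtain vs where vs: "set vs \<subseteq> K" "wp vs = wp us" "length vs = len (wp us)" by auto
    have sS: "s \<in> S" "set us \<subseteq> S" "set vs \<subseteq> S" using Cons.prems assms vs by auto
    then have "wp us \<in> carrier W" by simp
    with \<open>s \<in> S\<close> show ?case
    proof (cases rule: len_cases)
      case 1
      then show ?thesis using vs Cons.prems by (intro exI[of _ "s # vs"]) simp
    next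
      case 2
      then have "len (s \<otimes> wp vs) < len (wp vs)" using vs by simp
      then obtain xs y ys where "vs = xs @ y # ys" "s \<otimes> wp vs = wp (xs @ ys)"
        using exchange[of s vs] sS by blast
      then show ?thesis using 2 vs Cons.prems by (intro exI[of _ "xs @ ys"]) auto
    qed
  qed
  moreover obtain us where "set us \<subseteq> K" "wp us = w" using assms by (auto simp: generate_eq_words)
  ultimately show thesis using that by metis
qed

lemma len_1_imp_S:
  assumes "w \<in> carrier W" "len w = 1"
  shows "w \<in> S"
proof -
  obtain us where "set us \<subseteq> S" "wp us = w" "length us = 1"
    using reduced_word_exists[OF assms(1)] assms(2) by metis
  then show ?thesis by (auto simp: length_Suc_conv)
qed

lemma S_in_generate:
  assumes "K \<subseteq> S" "s \<in> S" "s \<in> generate W K"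
  shows "s \<in> K"
proof -
  obtain us where "set us \<subseteq> K" "wp us = s" "length us = 1"
    using reduced_word_in[OF assms(1,3)] assms(2) by (metis len_S)
  then show ?thesis using assms(1) by (auto simp: length_Suc_conv)
qed

lemma S_mult_one: "\<lbrakk>s \<in> S; t \<in> S; s \<otimes> t = \<one>\<rbrakk> \<Longrightarrow> s = t"
  using inv_equality[of s t] by simp

lemma S_mult_notin:
  assumes "s \<in> S" "t \<in> S" "s \<noteq> t"
  shows "s \<otimes> t \<notin> S"
proof
  assume "s \<otimes> t \<in> S"
  moreover have "s \<otimes> t \<in> generate W {s, t}" by (rule generate.eng) (auto intro: generate.incl)
  ultimately have "s \<otimes> t \<in> {s, t}" using assms S_in_generate[of "{s, t}" "s \<otimes> t"] by auto
  then show False using assms S_involution[of s] S_involution[of t] by auto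
qed

lemma generate_singleton:
  assumes "s \<in> S"
  shows "generate W {s} = {\<one>, s}"
proof
  show "generate W {s} \<subseteq> {\<one>, s}"
  proof
    fix w assume "w \<in> generate W {s}"
    then show "w \<in> {\<one>, s}" using assms by induction auto
  qed
qed (auto intro: generate.one generate.incl)

lemma len_mult_notin:
  assumes "K \<subseteq> S" "s \<in> S - K" "w \<in> generate W K"
  shows "len (s \<otimes> w) = len w + 1"
proof -
  obtain us where us: "set us \<subseteq> K" "wp us = w" using assms by (auto simp: generate_eq_words)
  have "s \<in> S" "w \<in> carrier W" using assms generate_carrier by auto
  then show ?thesis
  proof (cases rule: len_cases)
    case 2
    then have "len (s \<otimes> wp us) < len (wp us)" using us by simp
    moreover have "set us \<subseteq> S" using us assms by auto
    ultimately obtain xs y ys where "us = xs @ y # ys" "s \<otimes> wp us = wp (xs @ ys)"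
      using exchange[of s us] assms by blast
    then have "s \<otimes> w \<in> generate W K" using us wp_in_generate[of K "xs @ ys"] assms by auto
    then have "s \<in> generate W K" using generate_cancel_right[OF assms(1,3), of s] assms by auto
    then show ?thesis using S_in_generate[of K s] assms by auto
  qed
qed

text \<open>The elements \<open>w\<close> and \<open>s \<otimes> w \<otimes> t\<close> will be the
  displacements of two adjacent chambers. Writing \<open>s \<otimes> w = v \<otimes> t\<close> with
  \<open>v\<close> in the subgroup, multiplication by \<open>s\<close> shortens the right-hand side,
  and the proof asks which letter exchange deletes there.\<close>

lemma twisted_conjugate_in:
  assumes "K \<subseteq> S" "s \<in> S - K" "t \<in> S" "w \<in> generate W K" "s \<otimes> w \<otimes> t \<in> generate W K"
  shows "t = s \<and> s \<otimes> w = w \<otimes> s"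
proof -
  define v where "v = s \<otimes> w \<otimes> t"
  have c: "w \<in> carrier W" "v \<in> carrier W" "s \<in> carrier W" "t \<in> carrier W"
    using assms generate_carrier v_def by auto
  have vt: "v \<otimes> t = s \<otimes> w" using c assms by (simp add: v_def m_assoc)
  have tK: "t \<notin> generate W K"
  proof
    assume "t \<in> generate W K"
    then have "s \<otimes> w \<in> generate W K" using assms vt generate.eng v_def by metis
    then have "s \<in> generate W K" using generate_cancel_right[OF assms(1,4) c(3)] by simp
    then show False using S_in_generate[of K s] assms by auto
  qed
  obtain us where us: "set us \<subseteq> K" "wp us = v"
    using assms v_def by (auto simp: generate_eq_words)
  then have usS: "set us \<subseteq> S" "set (us @ [t]) \<subseteq> S" using assms by auto
  have wpt: "wp (us @ [t]) = s \<otimes> w" using us usS assms vt by (simp add: wp_append)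
  then have "len (s \<otimes> wp (us @ [t])) < len (wp (us @ [t]))"
    using len_mult_notin[OF assms(1,2,4)] assms c by simp
  then obtain xs y ys where d: "us @ [t] = xs @ y # ys" "s \<otimes> wp (us @ [t]) = wp (xs @ ys)"
    using exchange[of s "us @ [t]"] assms usS by blast
  have w: "w = wp (xs @ ys)" using d wpt assms c by simp
  \<comment> \<open>Deleting a letter of \<open>us\<close> would leave \<open>t\<close> at the end
    and force \<open>t\<close> into the subgroup; so the final \<open>t\<close> itself is
    deleted.\<close>
  have "w = v"
  proof (cases ys rule: rev_cases)
    case Nil
    then show ?thesis using d w us by simp
  next
    case (snoc zs z)
    then have "z = t" "us = xs @ y # zs" using d by auto
    then have "w = wp (xs @ zs) \<otimes> t" using w snoc usS wp_append[of "xs @ zs" "[t]"] assms by auto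
    moreover have "wp (xs @ zs) \<in> generate W K"
      using wp_in_generate assms us \<open>us = xs @ y # zs\<close> by auto
    ultimately have "t \<in> generate W K" using generate_cancel_left assms c by metis
    then show ?thesis using tK by simp
  qed
  then have sw: "s \<otimes> w = w \<otimes> t" using vt by simp
  have Kt: "insert t K \<subseteq> S" using assms by auto
  have "w \<in> generate W (insert t K)" using assms mono_generate[of K "insert t K"] by auto
  moreover from this have "s \<otimes> w \<in> generate W (insert t K)"
    unfolding sw by (rule generate.eng) (auto intro: generate.incl)
  ultimately have "s \<in> generate W (insert t K)"
    using generate_cancel_right[OF Kt _ c(3), of w] by simp
  then have "s \<in> insert t K" using S_in_generate[OF Kt, of s] assms by auto
  then show ?thesis using assms sw by auto
qed

text \<open>Induction on the first letter \<open>u\<close>, with tail value \<open>w\<close>. Since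
  \<open>s\<close> commutes with \<open>u \<otimes> w\<close>, multiplying
  \<open>s \<otimes> u \<otimes> w\<close> by \<open>u\<close> gives \<open>w \<otimes> s\<close>,
  which is shorter. Exchange then shows that conjugation by \<open>s\<close> keeps \<open>w\<close>
  in the subgroup, so \<open>s\<close> commutes with \<open>w\<close> and therefore with
  \<open>u\<close>.\<close>

lemma commuting_letters:
  assumes "K \<subseteq> S" "s \<in> S - K" "set us \<subseteq> K" "length us = len (wp us)" "s \<otimes> wp us = wp us \<otimes> s"
  shows "\<forall>u\<in>set us. s \<otimes> u = u \<otimes> s"
  using assms(3-5)
proof (induction us)
  case (Cons u us)
  note prems = Cons.prems
  let ?w = "wp us"
  have uS: "u \<in> S" "s \<in> S" "set us \<subseteq> S" "s \<noteq> u" using Cons.prems assms by auto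
  then have c: "u \<in> carrier W" "s \<in> carrier W" "?w \<in> carrier W" by auto
  have wK: "?w \<in> generate W K" "u \<otimes> ?w \<in> generate W K"
    using wp_in_generate[of K us] wp_in_generate[of K "u # us"] Cons.prems assms by auto
  have red: "length us = len ?w"
    using len_le[of us] len_mult_le[of u ?w] Cons.prems uS c by simp
  have com: "s \<otimes> (u \<otimes> ?w) = u \<otimes> (?w \<otimes> s)" using Cons.prems c by (simp add: m_assoc)
  then have ws: "u \<otimes> (s \<otimes> (u \<otimes> ?w)) = ?w \<otimes> s" using uS c by simp
  have "len (u \<otimes> (s \<otimes> (u \<otimes> ?w))) \<le> len ?w + 1"
    unfolding ws using len_mult_le[of ?w s] c uS by simp
  moreover have "len (s \<otimes> (u \<otimes> ?w)) = len ?w + 2"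
    using len_mult_notin[OF assms(1,2) wK(2)] Cons.prems red by simp
  ultimately have "len (u \<otimes> wp (s # u # us)) < len (wp (s # u # us))" by simp
  then obtain xs y ys where d: "s # u # us = xs @ y # ys" "u \<otimes> wp (s # u # us) = wp (xs @ ys)"
    using exchange[of u "s # u # us"] uS by auto
  \<comment> \<open>The leading \<open>s\<close> cannot be the deleted letter: this would give
    \<open>s \<otimes> (u \<otimes> ?w) = ?w\<close>, although \<open>s\<close> lengthens elements
    of the subgroup.\<close>
  have "\<exists>v\<in>generate W K. u \<otimes> (s \<otimes> (u \<otimes> ?w)) = s \<otimes> v"
  proof (cases xs)
    case Nil
    then have "ys = u # us" using d(1) by simp
    then have "u \<otimes> (s \<otimes> (u \<otimes> ?w)) = u \<otimes> ?w" using d(2) Nil by simp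
    then have "u \<otimes> (u \<otimes> (s \<otimes> (u \<otimes> ?w))) = u \<otimes> (u \<otimes> ?w)" by simp
    then have "s \<otimes> (u \<otimes> ?w) = ?w" using c uS by simp
    then have "len ?w = len (u \<otimes> ?w) + 1" using len_mult_notin[OF assms(1,2) wK(2)] by simp
    then have False using Cons.prems red by simp
    then show ?thesis ..
  next
    case (Cons a zs)
    then have "a = s" "u # us = zs @ y # ys" using d(1) by simp_all
    have "wp (xs @ ys) = s \<otimes> wp (zs @ ys)" using Cons \<open>a = s\<close> by simp
    then have "u \<otimes> (s \<otimes> (u \<otimes> ?w)) = s \<otimes> wp (zs @ ys)" using d(2) by (simp only: wp_Cons)
    moreover have "wp (zs @ ys) \<in> generate W K"
    proof (rule wp_in_generate[OF assms(1)])
      have "set (zs @ ys) \<subseteq> set (u # us)" unfolding \<open>u # us = zs @ y # ys\<close> by auto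
      then show "set (zs @ ys) \<subseteq> K" using prems(1) by (rule subset_trans)
    qed
    ultimately show ?thesis by blast
  qed
  then obtain v where v: "v \<in> generate W K" "?w \<otimes> s = s \<otimes> v" using ws by auto
  then have "s \<otimes> ?w \<otimes> s = v" using c uS generate_carrier[OF assms(1) v(1)] by (simp add: m_assoc)
  then have sw: "s \<otimes> ?w = ?w \<otimes> s"
    using twisted_conjugate_in[OF assms(1,2) _ wK(1), of s] v uS by simp
  then have "s \<otimes> u \<otimes> ?w = u \<otimes> s \<otimes> ?w" using com c by (simp add: m_assoc)
  then have "s \<otimes> u = u \<otimes> s" using c by simp
  then show ?case using Cons sw red by simp
qed simp

lemma cox_m_commute:
  assumes "s \<in> S" "u \<in> S" "s \<noteq> u" "s \<otimes> u = u \<otimes> s"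
  shows "cox_m W s u = 2"
proof -
  have "s \<otimes> u \<otimes> (s \<otimes> u) = s \<otimes> u \<otimes> (u \<otimes> s)" using assms(4) by simp
  then have "(s \<otimes> u) [^] (2::nat) = \<one>" using assms(1,2) by (simp add: numeral_2_eq_2 m_assoc)
  then have "ord (s \<otimes> u) dvd 2" using pow_eq_id[of "s \<otimes> u" 2] assms by simp
  moreover have "ord (s \<otimes> u) \<noteq> 1" using ord_eq_1[of "s \<otimes> u"] S_mult_one assms by auto
  ultimately show ?thesis
    unfolding cox_m_def by (metis prime_nat_iff two_is_prime_nat)
qed

text \<open>A reduced expression of \<open>w\<close> starting with one of \<open>v\<close> is built
  letter by letter. For a new letter \<open>c\<close>, exchange has to delete in the remaining
  factor \<open>w'\<close>, since a deletion in \<open>vs\<close> would contradict that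
  \<open>c # vs\<close> is reduced.\<close>

lemma len_factor:
  assumes K: "K \<subseteq> S" and w: "w \<in> carrier W" and top: "\<And>c. c \<in> K \<Longrightarrow> len (c \<otimes> w) < len w"
    and v: "v \<in> generate W K"
  shows "len w = len v + len (inv v \<otimes> w)"
proof -
  have *: "\<exists>w'\<in>carrier W. w = wp vs \<otimes> w' \<and> len w = length vs + len w'"
    if "set vs \<subseteq> K" "length vs = len (wp vs)" for vs
    using that
  proof (induction vs)
    case Nil
    then show ?case using w by (intro bexI[of _ w]) auto
  next
    case (Cons c vs)
    have cS: "c \<in> S" "c \<in> K" "set vs \<subseteq> S" using Cons.prems K by auto
    have "length vs = len (wp vs)"
      using len_le[of vs] len_mult_le[of c "wp vs"] Cons.prems cS by simp
    then obtain w' where w': "w' \<in> carrier W" "w = wp vs \<otimes> w'" "len w = length vs + len w'"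
      using Cons by auto
    obtain ws where ws: "set ws \<subseteq> S" "wp ws = w'" "length ws = len w'"
      using reduced_word_exists w'(1) by blast
    have app: "wp (vs @ ws) = w" using ws w' cS by (simp add: wp_append)
    then obtain xs y ys where d: "vs @ ws = xs @ y # ys" "c \<otimes> w = wp (xs @ ys)"
      using exchange[of c "vs @ ws"] cS ws top[of c] by (metis le_sup_iff set_append)
    from d(1) consider zs where "vs = xs @ y # zs" "ys = zs @ ws"
      | zs where "xs = vs @ zs" "ws = zs @ y # ys" unfolding append_eq_append_Cons_iff by blast
    then show ?case
    proof cases
      case 1
      then have sub: "set (xs @ zs) \<subseteq> S" using cS by auto
      have "c \<otimes> wp vs \<otimes> w' = wp (xs @ zs) \<otimes> w'"
        using d 1 w' ws cS sub wp_append[of "xs @ zs" ws] by (simp add: m_assoc)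
      then have "c \<otimes> wp vs = wp (xs @ zs)" using w' cS sub by (simp del: set_append)
      then have "len (wp (c # vs)) \<le> length (xs @ zs)" using len_le[OF sub] by simp
      then show ?thesis using Cons.prems 1 by simp
    next
      case 2
      let ?u = "wp (zs @ ys)"
      have sub: "set (zs @ ys) \<subseteq> S" using ws 2 by auto
      then have u: "?u \<in> carrier W" by (simp del: set_append)
      have "c \<otimes> w = wp vs \<otimes> ?u" using d 2 cS sub wp_append[of vs "zs @ ys"] by simp
      then have "c \<otimes> (c \<otimes> w) = c \<otimes> (wp vs \<otimes> ?u)" by simp
      then have eq: "w = wp (c # vs) \<otimes> ?u" using cS w u by (simp add: m_assoc)
      moreover have "len ?u \<le> length ws - 1" using len_le[OF sub] 2 by simp
      moreover have "len w \<le> len (wp (c # vs)) + len ?u"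
        unfolding eq using len_mult_le[of "wp (c # vs)" ?u] u cS by simp
      moreover have "length ws \<noteq> 0" using 2 by simp
      ultimately show ?thesis using u w' ws Cons.prems by (intro bexI[of _ ?u]) auto
    qed
  qed
  obtain vs where vs: "set vs \<subseteq> K" "wp vs = v" "length vs = len v"
    using reduced_word_in[OF K v] .
  then obtain w' where "w' \<in> carrier W" "w = v \<otimes> w'" "len w = len v + len w'"
    using *[of vs] by auto
  moreover from this have "inv v \<otimes> w = w'"
    using generate_carrier[OF K v] by (simp flip: m_assoc)
  ultimately show ?thesis by simp
qed

section \<open>Longest elements of parabolic subgroups\<close>

definition longest :: "'a set \<Rightarrow> 'a \<Rightarrow> bool" where
  "longest K w \<longleftrightarrow> w \<in> generate W K \<and> (\<forall>v\<in>generate W K. len v \<le> len w)"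

lemma longest_exists:
  assumes "finite (generate W K)"
  obtains w where "longest K w"
proof -
  have "generate W K \<noteq> {}" using generate.one by blast
  then have "Max (len ` generate W K) \<in> len ` generate W K" using assms by (intro Max_in) auto
  then obtain w where "w \<in> generate W K" "len w = Max (len ` generate W K)" by auto
  then show thesis using that[of w] assms by (simp add: longest_def)
qed

lemma longest_descent:
  assumes "K \<subseteq> S" "longest K w" "c \<in> K"
  shows "len (c \<otimes> w) < len w"
proof -
  have "c \<otimes> w \<in> generate W K" using assms by (auto simp: longest_def intro: generate.eng generate.incl)
  then have "len (c \<otimes> w) \<le> len w" using assms by (simp add: longest_def)
  moreover have "len (c \<otimes> w) \<noteq> len w"
    using len_mult_neq[of c w] assms generate_carrier[of K w] by (auto simp: longest_def)
  ultimately show ?thesis by simp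
qed

lemma longest_factor:
  assumes "K \<subseteq> S" "longest K w" "v \<in> generate W K"
  shows "len w = len v + len (inv v \<otimes> w)"
proof (rule len_factor[OF assms(1) _ _ assms(3)])
  show "w \<in> carrier W" using assms generate_carrier[of K w] by (simp add: longest_def)
qed (rule longest_descent[OF assms(1,2)])

lemma longest_unique:
  assumes "K \<subseteq> S" "longest K w" "longest K v"
  shows "v = w"
proof -
  have c: "v \<in> carrier W" "w \<in> carrier W" "v \<in> generate W K"
    using assms generate_carrier by (auto simp: longest_def)
  have "len v = len w" using assms by (auto simp: longest_def intro: le_antisym)
  then have "len (inv v \<otimes> w) = 0" using longest_factor[OF assms(1,2) c(3)] by simp
  then have "inv v \<otimes> w = \<one>" using len_0_iff c by simp
  then show ?thesis using c by (metis inv_closed inv_inv inv_equality)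
qed

lemma longest_inv:
  assumes "K \<subseteq> S" "longest K w"
  shows "inv w = w"
proof (rule longest_unique[OF assms])
  show "longest K (inv w)"
    using assms len_inv[of w] generate_inv[of K w] generate_carrier[of K w]
    by (simp add: longest_def)
qed

text \<open>This is the opposition involution on \<open>K\<close>: by additivity
  \<open>len (w \<otimes> x \<otimes> w)\<close> is the length lost in passing from \<open>w\<close>
  to \<open>x \<otimes> w\<close>, which is one.\<close>

lemma longest_conjugate:
  assumes K: "K \<subseteq> S" and w: "longest K w" and x: "x \<in> K"
  shows "w \<otimes> x \<otimes> w \<in> K"
proof -
  have c: "w \<in> generate W K" "w \<in> carrier W" "x \<in> S" "x \<in> generate W K"
    using assms generate_carrier by (auto simp: longest_def intro: generate.incl)
  have xw: "x \<otimes> w \<in> generate W K" using c by (intro generate.eng)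
  have eq: "inv (x \<otimes> w) \<otimes> w = w \<otimes> x \<otimes> w"
    using c longest_inv[OF K w] by (simp add: inv_mult_group)
  have "len w = len (x \<otimes> w) + len (w \<otimes> x \<otimes> w)"
    using longest_factor[OF K w xw] eq by simp
  moreover have "len w \<le> len (x \<otimes> w) + 1"
    using len_mult_le[of x "x \<otimes> w"] c by simp
  ultimately have "len (w \<otimes> x \<otimes> w) = 1" using longest_descent[OF K w x] by simp
  then have "w \<otimes> x \<otimes> w \<in> S" using c by (intro len_1_imp_S) simp_all
  moreover have "w \<otimes> x \<otimes> w \<in> generate W K" using c by (intro generate.eng)
  ultimately show ?thesis using S_in_generate[OF K] by simp
qed

end

section \<open>Closed walks of prime power length\<close>

text \<open>Orbit lengths divide \<open>p ^ r\<close> and exceed 1, so each is divisible by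
  \<open>p\<close>; the induction splits off one orbit.\<close>

lemma prime_dvd_card_no_fixpoint:
  assumes "prime p" "finite A" "\<And>x. x \<in> A \<Longrightarrow> f x \<in> A"
    "\<And>x. x \<in> A \<Longrightarrow> (f ^^ (p ^ r)) x = x" "\<And>x. x \<in> A \<Longrightarrow> f x \<noteq> x"
  shows "p dvd card A"
  using assms(2-5)
proof (induction A rule: finite_psubset_induct)
  case (psubset A)
  show ?case
  proof (cases "A = {}")
    case False
    then obtain x where x: "x \<in> A" by blast
    define d where "d = (LEAST d. 0 < d \<and> (f ^^ d) x = x)"
    have pr: "0 < p ^ r \<and> (f ^^ (p ^ r)) x = x"
      using x psubset.prems assms(1) by (simp add: prime_gt_0_nat)
    have d: "0 < d" "(f ^^ d) x = x"
      using LeastI[of "\<lambda>d. 0 < d \<and> (f ^^ d) x = x", OF pr] by (auto simp: d_def)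
    have least: "\<not> (0 < k \<and> (f ^^ k) x = x)" if "k < d" for k
      using that not_less_Least unfolding d_def by blast
    define Orb where "Orb = (\<lambda>i. (f ^^ i) x) ` {..<d}"
    have inj: "inj_on (\<lambda>i. (f ^^ i) x) {..<d}"
    proof (rule linorder_inj_onI)
      fix i j assume ij: "i < j" "i \<in> {..<d}" "j \<in> {..<d}"
      show "(f ^^ i) x \<noteq> (f ^^ j) x"
      proof
        assume "(f ^^ i) x = (f ^^ j) x"
        then have "(f ^^ (d - j)) ((f ^^ i) x) = (f ^^ (d - j)) ((f ^^ j) x)" by simp
        also have "\<dots> = x" using ij d by (simp flip: funpow_add[THEN fun_cong, unfolded o_apply])
        finally have "(f ^^ (d - j + i)) x = x" by (simp add: funpow_add)
        then show False using least[of "d - j + i"] ij by auto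
      qed
    qed auto
    have "d dvd p ^ r"
    proof -
      have "(f ^^ (p ^ r mod d)) x = x" using funpow_mod_eq[OF d(2)] pr by simp
      then show ?thesis using least[of "p ^ r mod d"] d by (auto simp: dvd_eq_mod_eq_0)
    qed
    moreover have "d \<noteq> 1" using d psubset.prems(3)[OF x] by auto
    ultimately have "p dvd d"
      using divides_primepow_nat[OF assms(1)] by (metis dvd_power neq0_conv power_0)
    then have cO: "p dvd card Orb" using card_image[OF inj] by (simp add: Orb_def)
    have mem: "(f ^^ i) x \<in> Orb" for i
      using d by (auto simp: Orb_def simp flip: funpow_mod_eq[OF d(2), of i])
    have "(f ^^ i) x \<in> A" for i using x psubset.prems(1) by (induction i) auto
    then have sub: "Orb \<subseteq> A" by (auto simp: Orb_def)
    have "x \<in> Orb" using mem[of 0] by simp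
    then have "A - Orb \<subset> A" using x by blast
    moreover have "f y \<in> A - Orb" if "y \<in> A - Orb" for y
    proof -
      have "f y \<notin> Orb"
      proof
        assume "f y \<in> Orb"
        then obtain i where "f y = (f ^^ i) x" by (auto simp: Orb_def)
        then have "(f ^^ (p ^ r - 1)) (f y) = (f ^^ (p ^ r - 1 + i)) x"
          by (simp add: funpow_add)
        moreover have "(f ^^ (p ^ r - 1)) (f y) = (f ^^ (p ^ r)) y"
          using pr by (metis Suc_diff_1 comp_apply funpow_Suc_right)
        ultimately have "y \<in> Orb" using mem[of "p ^ r - 1 + i"] that psubset.prems(2)[of y] by auto
        then show False using that by simp
      qed
      then show ?thesis using that psubset.prems(1) by simp
    qed
    ultimately have "p dvd card (A - Orb)" using psubset.prems by (intro psubset.IH) auto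
    moreover have "card A = card Orb + card (A - Orb)"
      using sub psubset.hyps
      by (metis card_Diff_subset card_mono finite_subset le_add_diff_inverse)
    ultimately show ?thesis using cO by simp
  qed simp
qed

text \<open>Indices modulo \<open>n\<close> close the walk without repeating its base point, so that
  rotating the list acts on closed walks.\<close>

definition closed_walks :: "('a \<Rightarrow> 'a \<Rightarrow> bool) \<Rightarrow> 'a set \<Rightarrow> nat \<Rightarrow> 'a list set" where
  "closed_walks E R n =
     {xs. set xs \<subseteq> R \<and> length xs = n \<and> (\<forall>i<n. E (xs ! i) (xs ! (Suc i mod n)))}"

lemma finite_closed_walks: "finite R \<Longrightarrow> finite (closed_walks E R n)"
  by (rule finite_subset[OF _ finite_lists_length_eq[of R n]]) (auto simp: closed_walks_def)

lemma prime_dvd_card_closed_walks: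
  assumes "prime p" "finite R" "\<And>x. x \<in> R \<Longrightarrow> \<not> E x x"
  shows "p dvd card (closed_walks E R (p ^ r))"
proof (rule prime_dvd_card_no_fixpoint[where f = rotate1 and r = r])
  have n: "0 < p ^ r" using assms(1) by (simp add: prime_gt_0_nat)
  fix xs assume xs: "xs \<in> closed_walks E R (p ^ r)"
  then have l: "length xs = p ^ r" by (simp add: closed_walks_def)
  have "E (rotate1 xs ! i) (rotate1 xs ! (Suc i mod p ^ r))" if "i < p ^ r" for i
  proof -
    have "Suc i mod p ^ r < p ^ r" using n by simp
    then show ?thesis using that xs l by (simp add: nth_rotate1 closed_walks_def)
  qed
  then show "rotate1 xs \<in> closed_walks E R (p ^ r)" using xs by (simp add: closed_walks_def)
  show "(rotate1 ^^ (p ^ r)) xs = xs" using rotate_id[of "p ^ r" xs] l by (simp add: rotate_def)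
  show "rotate1 xs \<noteq> xs"
  proof
    \<comment> \<open>A list fixed by rotation starts with two equal vertices, which gives a loop of
      \<open>E\<close>. For \<open>r = 0\<close> the index \<open>Suc 0 mod 1\<close> is
      \<open>0\<close>, and the only edge is itself a loop.\<close>
    assume "rotate1 xs = xs"
    then have "xs ! (Suc 0 mod p ^ r) = xs ! 0" using nth_rotate1[of 0 xs] l n by simp
    moreover have "E (xs ! 0) (xs ! (Suc 0 mod p ^ r))"
      using xs n unfolding closed_walks_def by blast
    moreover have "xs ! 0 \<in> R" using xs n nth_mem[of 0 xs] by (auto simp: closed_walks_def)
    ultimately show False using assms(3)[of "xs ! 0"] by simp
  qed
qed (use assms in \<open>simp_all add: finite_closed_walks\<close>)

text \<open>The final vertex \<open>y\<close> is left out, so that a walk from \<open>x\<close> to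
  \<open>x\<close> is the same list as in \<open>closed_walks\<close>;
  \<open>hd (xs @ [y]) = x\<close> also covers \<open>n = 0\<close>, where it means
  \<open>x = y\<close>.\<close>

definition walks :: "('a \<Rightarrow> 'a \<Rightarrow> bool) \<Rightarrow> 'a set \<Rightarrow> nat \<Rightarrow> 'a \<Rightarrow> 'a \<Rightarrow> 'a list set" where
  "walks E R n x y =
     {xs. set xs \<subseteq> R \<and> length xs = n \<and> hd (xs @ [y]) = x \<and>
          (\<forall>i<n. E ((xs @ [y]) ! i) ((xs @ [y]) ! Suc i))}"

definition transfer :: "('a \<Rightarrow> 'a \<Rightarrow> bool) \<Rightarrow> 'a set \<Rightarrow> ('a \<Rightarrow> int) \<Rightarrow> 'a \<Rightarrow> int" where
  "transfer E R f x = (\<Sum>y\<in>{y\<in>R. E x y}. f y)"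

lemma finite_walks: "finite R \<Longrightarrow> finite (walks E R n x y)"
  by (rule finite_subset[OF _ finite_lists_length_eq[of R n]]) (auto simp: walks_def)

lemma walks_Suc:
  assumes "x \<in> R" "y \<in> R"
  shows "walks E R (Suc n) x y = (\<Union>z\<in>{z\<in>R. E x z}. (#) x ` walks E R n z y)"
proof (intro equalityI subsetI)
  fix ws assume ws: "ws \<in> walks E R (Suc n) x y"
  then obtain a xs where a: "ws = a # xs" "length xs = n" by (auto simp: walks_def length_Suc_conv)
  have ax: "a = x" "set xs \<subseteq> R" using ws a by (auto simp: walks_def)
  have E: "E ((ws @ [y]) ! i) ((ws @ [y]) ! Suc i)" if "i < Suc n" for i
    using ws that by (simp add: walks_def)
  define z where "z = hd (xs @ [y])"
  have "z \<in> R" using ax assms by (cases xs) (auto simp: z_def)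
  moreover have "E x z" using E[of 0] a ax by (simp add: z_def hd_conv_nth)
  moreover have "xs \<in> walks E R n z y"
    using E[of "Suc _"] a ax by (simp add: walks_def z_def)
  ultimately show "ws \<in> (\<Union>z\<in>{z\<in>R. E x z}. (#) x ` walks E R n z y)" using a ax by blast
next
  fix ws assume "ws \<in> (\<Union>z\<in>{z\<in>R. E x z}. (#) x ` walks E R n z y)"
  then obtain z xs where z: "z \<in> R" "E x z" "xs \<in> walks E R n z y" "ws = x # xs" by blast
  have "E ((ws @ [y]) ! i) ((ws @ [y]) ! Suc i)" if "i < Suc n" for i
    using z that by (cases i) (auto simp: walks_def hd_conv_nth)
  then show "ws \<in> walks E R (Suc n) x y" using z assms by (auto simp: walks_def)
qed

lemma card_walks:
  assumes "finite R" "x \<in> R" "y \<in> R"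
  shows "int (card (walks E R n x y)) = (transfer E R ^^ n) (\<lambda>z. if z = y then 1 else 0) x"
  using assms(2)
proof (induction n arbitrary: x)
  case 0
  have "walks E R 0 x y = (if x = y then {[]} else {})" by (auto simp: walks_def)
  then show ?case by simp
next
  case (Suc n)
  have "card (walks E R (Suc n) x y) = (\<Sum>z\<in>{z\<in>R. E x z}. card ((#) x ` walks E R n z y))"
    unfolding walks_Suc[OF Suc.prems assms(3)] using assms(1)
    by (intro card_UN_disjoint) (auto simp: finite_walks, auto simp: walks_def)
  also have "\<dots> = (\<Sum>z\<in>{z\<in>R. E x z}. card (walks E R n z y))"
    by (intro sum.cong card_image) auto
  finally show ?case using Suc.IH by (simp add: transfer_def)
qed

lemma card_closed_walks:
  assumes "finite R" "0 < n"
  shows "int (card (closed_walks E R n)) =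
    (\<Sum>x\<in>R. (transfer E R ^^ n) (\<lambda>z. if z = x then 1 else 0) x)"
proof -
  have iff: "(\<forall>i<n. E ((xs @ [x]) ! i) ((xs @ [x]) ! Suc i)) \<longleftrightarrow>
      (\<forall>i<n. E (xs ! i) (xs ! (Suc i mod n)))"
    if "length xs = n" "hd xs = x" for xs x
  proof -
    have "(xs @ [x]) ! Suc i = xs ! (Suc i mod n)" if "i < n" for i
    proof (cases "Suc i = n")
      case True
      moreover have "xs ! 0 = x"
        using \<open>length xs = n\<close> \<open>hd xs = x\<close> assms(2) by (cases xs) auto
      ultimately show ?thesis using \<open>length xs = n\<close> by (simp add: nth_append)
    next
      case False
      then show ?thesis using that \<open>length xs = n\<close> by (simp add: nth_append)
    qed
    then show ?thesis using \<open>length xs = n\<close> by (simp add: nth_append)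
  qed
  have "closed_walks E R n = (\<Union>x\<in>R. walks E R n x x)"
  proof (intro equalityI subsetI)
    fix xs assume xs: "xs \<in> closed_walks E R n"
    then have ne: "xs \<noteq> []" "length xs = n" using assms(2) by (auto simp: closed_walks_def)
    have "hd xs \<in> R" using xs ne hd_in_set by (auto simp: closed_walks_def)
    moreover have "xs \<in> walks E R n (hd xs) (hd xs)"
      using xs iff[of xs "hd xs"] ne by (simp add: walks_def closed_walks_def)
    ultimately show "xs \<in> (\<Union>x\<in>R. walks E R n x x)" by blast
  next
    fix xs assume "xs \<in> (\<Union>x\<in>R. walks E R n x x)"
    then obtain x where "x \<in> R" "xs \<in> walks E R n x x" by blast
    moreover from this have "hd xs = x" using assms(2) by (cases xs) (auto simp: walks_def)
    ultimately show "xs \<in> closed_walks E R n"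
      using iff[of xs x] by (simp add: walks_def closed_walks_def)
  qed
  moreover have "card (\<Union>x\<in>R. walks E R n x x) = (\<Sum>x\<in>R. card (walks E R n x x))"
  proof (rule card_UN_disjoint)
    have "hd xs = x" if "xs \<in> walks E R n x x" for x xs
      using that assms(2) by (cases xs) (auto simp: walks_def)
    then show "\<forall>x\<in>R. \<forall>y\<in>R. x \<noteq> y \<longrightarrow> walks E R n x x \<inter> walks E R n y y = {}" by blast
  qed (use assms in \<open>auto simp: finite_walks\<close>)
  ultimately show ?thesis using assms by (simp add: card_walks)
qed

text \<open>A case of the congruence \<open>tr (A ^ (p ^ r)) = tr A\<close> modulo \<open>p\<close>
  for integer matrices: \<open>A\<close> is the adjacency matrix of \<open>E\<close>, whose diagonal
  is zero.\<close>

lemma prime_dvd_trace_transfer: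
  assumes "prime p" "finite R" "\<And>x. x \<in> R \<Longrightarrow> \<not> E x x"
  shows "int p dvd (\<Sum>x\<in>R. (transfer E R ^^ (p ^ r)) (\<lambda>z. if z = x then 1 else 0) x)"
proof -
  have "0 < p ^ r" using assms(1) by (simp add: prime_gt_0_nat)
  have "p dvd card (closed_walks E R (p ^ r))"
    using assms by (rule prime_dvd_card_closed_walks)
  then have "int p dvd int (card (closed_walks E R (p ^ r)))" by simp
  then show ?thesis unfolding card_closed_walks[OF assms(2) \<open>0 < p ^ r\<close>] .
qed

section \<open>Residues of buildings\<close>

context building
begin

lemma \<delta>_self [simp]: "C \<in> Ch \<Longrightarrow> \<delta> C C = \<one>"
  using WD1 by blast

lemma \<delta>_sym_S:
  assumes "C \<in> Ch" "D \<in> Ch" "\<delta> C D = s" "s \<in> S"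
  shows "\<delta> D C = s"
proof -
  have "\<delta> C C \<in> {s \<otimes> \<delta> D C, \<delta> D C}" using WD2[of D C C s] assms by simp
  moreover have "\<delta> D C \<noteq> \<one>" using WD1[of D C] WD1[of C D] assms S_involution by auto
  ultimately have "s \<otimes> \<delta> D C = \<one>" using assms(1) by auto
  then have "inv (\<delta> D C) = s" using assms \<delta>_closed by (intro inv_equality) auto
  then have "inv (inv (\<delta> D C)) = inv s" by simp
  then show ?thesis using assms \<delta>_closed by simp
qed

lemma \<delta>_panel:
  assumes "C \<in> Ch" "D \<in> Ch" "E \<in> Ch" "s \<in> S" "\<delta> C D \<in> {\<one>, s}" "\<delta> D E \<in> {\<one>, s}"
  shows "\<delta> C E \<in> {\<one>, s}"
proof (cases "\<delta> C D = \<one>")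
  case True
  then show ?thesis using assms WD1 by auto
next
  case False
  then have "\<delta> C E \<in> {s \<otimes> \<delta> D E, \<delta> D E}" using WD2[of D C E s] assms by auto
  then show ?thesis using assms by auto
qed

lemma \<delta>_panel_sym: "\<lbrakk>C \<in> Ch; D \<in> Ch; s \<in> S; \<delta> C D \<in> {\<one>, s}\<rbrakk> \<Longrightarrow> \<delta> D C \<in> {\<one>, s}"
  using \<delta>_sym_S[of C D s] WD1[of C D] by auto

lemma \<delta>_two:
  assumes "C \<in> Ch" "D \<in> Ch" "E \<in> Ch" "\<delta> C D = s" "\<delta> D E = t" "s \<in> S" "t \<in> S" "s \<noteq> t"
  shows "\<delta> C E = s \<otimes> t"
proof -
  have "len (s \<otimes> t) = len t + 1"
    using assms by (intro len_mult_notin[of "{t}"]) (auto intro: generate.incl)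
  then show ?thesis using WD2[of D C E s t] assms by auto
qed

lemma residue_induct [consumes 4, case_names base step]:
  assumes "K \<subseteq> S" "C \<in> Ch" "D \<in> Ch" "\<delta> C D \<in> generate W K" and base: "P D"
    and step: "\<And>X Y s. \<lbrakk>X \<in> Ch; Y \<in> Ch; s \<in> K; \<delta> X Y = s; \<delta> Y D \<in> generate W K; P Y\<rbrakk> \<Longrightarrow> P X"
  shows "P C"
proof -
  obtain us where "set us \<subseteq> K" "\<delta> C D = wp us" using assms by (auto simp: generate_eq_words)
  then show ?thesis using assms(2)
  proof (induction us arbitrary: C)
    case Nil
    then show ?case using WD1[of C D] assms(3) base by simp
  next
    case (Cons s us)
    have s: "s \<in> K" "s \<in> S" "set us \<subseteq> S" using Cons.prems assms(1) by auto
    obtain Y where Y: "Y \<in> Ch" "\<delta> Y C = s" "\<delta> Y D = s \<otimes> wp (s # us)"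
      using WD3[of C D s "wp (s # us)"] Cons.prems s assms(3) by auto
    then have "\<delta> Y D = wp us" using s by simp
    moreover from this have "\<delta> Y D \<in> generate W K"
      using wp_in_generate[OF assms(1), of us] Cons.prems by simp
    ultimately show ?case
      using Cons Y s \<delta>_sym_S[of Y C s] step[of C Y s] by simp
  qed
qed

text \<open>\<open>WD2\<close> leaves two possibilities at each step of a gallery from
  \<open>C\<close> to \<open>D\<close>, so the factor \<open>v\<close> is not determined, but it
  stays in the subgroup. Symmetry and transitivity of lying in a common residue follow.\<close>

lemma \<delta>_generate_mult:
  assumes "K \<subseteq> S" "C \<in> Ch" "D \<in> Ch" "E \<in> Ch" "\<delta> C D \<in> generate W K"
  obtains v where "v \<in> generate W K" "\<delta> C E = v \<otimes> \<delta> D E"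
proof -
  have "\<exists>v\<in>generate W K. \<delta> C E = v \<otimes> \<delta> D E"
    using assms(1-3,5)
  proof (induction rule: residue_induct)
    case base
    show ?case using assms \<delta>_closed by (intro bexI[of _ \<one>]) (auto intro: generate.one)
  next
    case (step X Y s)
    then obtain v where v: "v \<in> generate W K" "\<delta> Y E = v \<otimes> \<delta> D E" by blast
    have s: "s \<in> generate W K" "s \<in> S" using step assms generate.incl by auto
    have "\<delta> X E \<in> {s \<otimes> \<delta> Y E, \<delta> Y E}" using WD2[of Y X E s] step s assms by simp
    then show ?case
    proof
      assume "\<delta> X E = s \<otimes> \<delta> Y E"
      then have "\<delta> X E = (s \<otimes> v) \<otimes> \<delta> D E"
        using v s assms \<delta>_closed generate_carrier by (simp add: m_assoc)
      then show ?thesis using generate.eng[OF s(1) v(1)] by blast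
    qed (use v in auto)
  qed
  then show thesis using that by blast
qed

lemma \<delta>_generate_sym:
  assumes "K \<subseteq> S" "C \<in> Ch" "D \<in> Ch" "\<delta> C D \<in> generate W K"
  shows "\<delta> D C \<in> generate W K"
proof -
  obtain v where "v \<in> generate W K" "\<delta> C C = v \<otimes> \<delta> D C"
    using \<delta>_generate_mult[OF assms(1-3,2,4)] .
  then show ?thesis
    using generate_cancel_left[OF assms(1), of v "\<delta> D C"] assms \<delta>_closed generate.one[of W K]
    by simp
qed

lemma \<delta>_generate_trans:
  assumes "K \<subseteq> S" "C \<in> Ch" "D \<in> Ch" "E \<in> Ch"
    "\<delta> C D \<in> generate W K" "\<delta> D E \<in> generate W K"
  shows "\<delta> C E \<in> generate W K"
proof -
  obtain v where "v \<in> generate W K" "\<delta> C E = v \<otimes> \<delta> D E"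
    using \<delta>_generate_mult[OF assms(1-5)] .
  then show ?thesis using generate.eng[OF _ assms(6)] by simp
qed

lemma residue_subset: "R \<in> residues_of_type W Ch \<delta> K \<Longrightarrow> R \<subseteq> Ch"
  by (auto simp: residues_of_type_def residue_of_def)

lemma residue_nonempty: "R \<in> residues_of_type W Ch \<delta> K \<Longrightarrow> R \<noteq> {}"
  using generate.one by (fastforce simp: residues_of_type_def residue_of_def)

lemma residue_\<delta>:
  assumes "K \<subseteq> S" "R \<in> residues_of_type W Ch \<delta> K" "C \<in> R" "D \<in> R"
  shows "\<delta> C D \<in> generate W K"
proof -
  obtain C0 where "C0 \<in> Ch" "R = {D \<in> Ch. \<delta> C0 D \<in> generate W K}"
    using assms by (auto simp: residues_of_type_def residue_of_def)
  then show ?thesis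
    using assms \<delta>_generate_trans[of K C C0 D] \<delta>_generate_sym[of K C0 C] by auto
qed

lemma residue_closed:
  assumes "K \<subseteq> S" "R \<in> residues_of_type W Ch \<delta> K" "C \<in> R" "D \<in> Ch" "\<delta> C D \<in> generate W K"
  shows "D \<in> R"
proof -
  obtain C0 where "C0 \<in> Ch" "R = {D \<in> Ch. \<delta> C0 D \<in> generate W K}"
    using assms by (auto simp: residues_of_type_def residue_of_def)
  then show ?thesis using assms \<delta>_generate_trans[of K C0 C D] by auto
qed

lemma residue_closed':
  assumes "K \<subseteq> S" "R \<in> residues_of_type W Ch \<delta> K" "C \<in> R" "D \<in> Ch" "\<delta> D C \<in> generate W K"
  shows "D \<in> R"
  using residue_closed[OF assms(1-4)] \<delta>_generate_sym[OF assms(1,4) _ assms(5)] residue_subset assms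
  by blast

lemma \<delta>_surj:
  assumes "C \<in> Ch" "w \<in> carrier W"
  obtains D where "D \<in> Ch" "\<delta> D C = w"
proof -
  have "\<exists>D\<in>Ch. \<delta> D C = wp us" if "set us \<subseteq> S" for us
    using that
  proof (induction us)
    case Nil
    show ?case using assms by (intro bexI[of _ C]) auto
  next
    case (Cons s us)
    then obtain D where "D \<in> Ch" "\<delta> D C = wp us" by auto
    then show ?case using WD3[of D C s "wp us"] Cons.prems assms by auto
  qed
  moreover obtain us where "set us \<subseteq> S" "wp us = w" using reduced_word_exists[OF assms(2)] by metis
  ultimately show thesis using that by blast
qed

end

section \<open>Counting galleries modulo a prime\<close>

context coxeter_system
begin

text \<open>For a reduced word these are the elements below its value in the Bruhat order. In a
  building they are the distances covered by galleries of type \<open>us\<close> that may stand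
  still.\<close>

definition subprods :: "'a list \<Rightarrow> 'a set" where
  "subprods us = wp ` {vs. subseq vs us}"

lemma subprods_Nil: "subprods [] = {\<one>}"
  proof -
  have "{vs :: 'a list. subseq vs []} = {[]}" by (auto dest: list_emb_Nil2)
  then show ?thesis by (simp add: subprods_def)
qed

lemma subprods_Cons: "subprods (x # us) = subprods us \<union> (\<lambda>w. x \<otimes> w) ` subprods us"
proof (intro equalityI subsetI)
  fix w assume "w \<in> subprods (x # us)"
  then obtain vs where vs: "subseq vs (x # us)" "w = wp vs" by (auto simp: subprods_def)
  from vs(1) show "w \<in> subprods us \<union> (\<lambda>w. x \<otimes> w) ` subprods us"
  proof cases
    case list_emb_Cons
    then show ?thesis using vs by (auto simp: subprods_def)
  next
    case (list_emb_Cons2 y ys)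
    then show ?thesis using vs by (auto simp: subprods_def)
  next
    case list_emb_Nil
    then have "w = wp []" using vs by simp
    then show ?thesis unfolding subprods_def by blast
  qed
next
  fix w assume "w \<in> subprods us \<union> (\<lambda>w. x \<otimes> w) ` subprods us"
  then consider vs where "subseq vs us" "w = wp vs" | vs where "subseq vs us" "w = wp (x # vs)"
    by (auto simp: subprods_def)
  then show "w \<in> subprods (x # us)"
    by cases (unfold subprods_def, auto intro!: image_eqI simp del: wp_Cons)
qed

lemma subprods_carrier: "set us \<subseteq> S \<Longrightarrow> subprods us \<subseteq> carrier W"
  by (induction us) (auto simp: subprods_Nil subprods_Cons)

text \<open>Exchange turns a subword into a smaller subword. This closure under left descents is the
  hypothesis on \<open>B\<close> in \<open>panel_count\<close>.\<close>

lemma subprods_descent: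
  assumes "x \<in> S" "set us \<subseteq> S" "w \<in> subprods us" "len (x \<otimes> w) < len w"
  shows "x \<otimes> w \<in> subprods us"
proof -
  obtain vs where vs: "subseq vs us" "w = wp vs" using assms by (auto simp: subprods_def)
  then have "set vs \<subseteq> S" using assms set_nths_subset by (metis subseq_conv_nths subset_trans)
  then obtain xs y ys where d: "vs = xs @ y # ys" "x \<otimes> w = wp (xs @ ys)"
    using exchange[of x vs] assms vs by metis
  have "subseq (xs @ ys) vs" unfolding d by (intro list_emb_append_mono) auto
  then have "subseq (xs @ ys) us" using vs subseq_order.trans by blast
  then show ?thesis using d by (auto simp: subprods_def)
qed

lemma subprods_mono: "subseq us vs \<Longrightarrow> subprods us \<subseteq> subprods vs"
  unfolding subprods_def using subseq_order.trans by blast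

end

section \<open>Panel sums on a finite residue modulo a prime\<close>

locale residue_mod_prime = building +
  fixes K :: "'a set" and R :: "'c set" and p :: nat
  assumes K: "K \<subseteq> S" and R: "R \<in> residues_of_type W Ch \<delta> K" and fin: "finite R" and p: "prime p"
    and panel_card: "\<lbrakk>x \<in> K; C \<in> R\<rbrakk> \<Longrightarrow> [int (card {D\<in>R. \<delta> C D \<in> {\<one>, x}}) = 1] (mod int p)"
begin

definition panel :: "'a \<Rightarrow> 'c \<Rightarrow> 'c set" where
  "panel x C = {D\<in>R. \<delta> C D \<in> {\<one>, x}}"

definition panel_sum :: "'a \<Rightarrow> ('c \<Rightarrow> int) \<Rightarrow> 'c \<Rightarrow> int" where
  "panel_sum x f C = (\<Sum>D\<in>panel x C. f D)"

lemma R_Ch: "C \<in> R \<Longrightarrow> C \<in> Ch"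
  using residue_subset R by blast

lemma finite_panel [simp]: "finite (panel x C)"
  using fin by (simp add: panel_def)

text \<open>In the panel of \<open>C\<close> there is one chamber nearest to \<open>D\<close>, and modulo \<open>p\<close> the others do not
  count.\<close>

lemma panel_count:
  assumes x: "x \<in> K" and C: "C \<in> R" and D: "D \<in> R" and Bc: "B \<subseteq> carrier W"
    and B: "\<And>w. \<lbrakk>w \<in> B; len (x \<otimes> w) < len w\<rbrakk> \<Longrightarrow> x \<otimes> w \<in> B"
  shows "[int (card {E\<in>panel x C. \<delta> E D \<in> B}) = (if \<delta> C D \<in> B \<union> (\<lambda>w. x \<otimes> w) ` B then 1 else 0)]
    (mod int p)"
proof -
  have xS: "x \<in> S" using x K by blast
  define w where "w = \<delta> C D"
  have wc: "w \<in> carrier W" using C D R_Ch \<delta>_closed by (simp add: w_def)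
  \<comment> \<open>\<open>C0\<close> is the projection of \<open>D\<close> to the panel:
    \<open>C\<close> itself or, if \<open>x\<close> shortens \<open>w\<close>, the neighbour
    supplied by \<open>WD3\<close>.\<close>
  have "\<exists>C0\<in>panel x C. len (x \<otimes> \<delta> C0 D) = len (\<delta> C0 D) + 1 \<and> w \<in> {\<delta> C0 D, x \<otimes> \<delta> C0 D}"
    using xS wc
  proof (cases rule: len_cases)
    case 1
    then show ?thesis using C R_Ch by (intro bexI[of _ C]) (auto simp: panel_def w_def)
  next
    case 2
    obtain C0 where C0: "C0 \<in> Ch" "\<delta> C0 C = x" "\<delta> C0 D = x \<otimes> w"
      using WD3[of C D x w] C D R_Ch xS w_def by auto
    then have "\<delta> C C0 = x" using \<delta>_sym_S[of C0 C x] C R_Ch xS by simp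
    moreover from this have "C0 \<in> R"
      using residue_closed[OF K R C C0(1)] x generate.incl by metis
    ultimately show ?thesis using C0 2 xS wc by (intro bexI[of _ C0]) (auto simp: panel_def)
  qed
  then obtain C0 where C0: "C0 \<in> panel x C" "len (x \<otimes> \<delta> C0 D) = len (\<delta> C0 D) + 1"
    "w \<in> {\<delta> C0 D, x \<otimes> \<delta> C0 D}" by blast
  define v where "v = \<delta> C0 D"
  have C0R: "C0 \<in> R" "C0 \<in> Ch" using C0 R_Ch by (auto simp: panel_def)
  have vc: "v \<in> carrier W" using C0R D R_Ch \<delta>_closed by (simp add: v_def)
  have other: "\<delta> E D = x \<otimes> v" if E: "E \<in> panel x C" "E \<noteq> C0" for E
  proof -
    have E': "E \<in> Ch" "\<delta> C E \<in> {\<one>, x}" using E R_Ch by (auto simp: panel_def)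
    then have "\<delta> E C \<in> {\<one>, x}" using \<delta>_panel_sym C R_Ch xS by blast
    moreover have "\<delta> C C0 \<in> {\<one>, x}" using C0 by (simp add: panel_def)
    ultimately have "\<delta> E C0 \<in> {\<one>, x}" using \<delta>_panel[of E C C0 x] E' C C0R R_Ch xS by blast
    then have "\<delta> E C0 = x" using WD1[of E C0] E' C0R E by auto
    then show ?thesis
      using WD2[of C0 E D x v] C0R E' D R_Ch xS C0(2) v_def by auto
  qed
  \<comment> \<open>The distances from the panel to \<open>D\<close> are \<open>v\<close> once and
    \<open>x \<otimes> v\<close> otherwise. Closure of \<open>B\<close> excludes that only
    \<open>x \<otimes> v\<close> lies in \<open>B\<close>; the count would then miss one chamber of
    the panel and be 0 instead of 1 modulo \<open>p\<close>.\<close>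
  have down: "v \<in> B" if "x \<otimes> v \<in> B"
    using B[OF that] C0(2) xS vc by (simp add: v_def[symmetric])
  show ?thesis
  proof (cases "v \<in> B")
    case True
    then have rhs: "\<delta> C D \<in> B \<union> (\<lambda>w. x \<otimes> w) ` B" using C0(3) by (auto simp: v_def w_def)
    show ?thesis
    proof (cases "x \<otimes> v \<in> B")
      case True
      then have "{E\<in>panel x C. \<delta> E D \<in> B} = panel x C"
        using other \<open>v \<in> B\<close> v_def by (metis (mono_tags, lifting) Collect_cong Collect_mem_eq)
      then show ?thesis using rhs panel_card[OF x C] by (simp add: panel_def)
    next
      case False
      have "E = C0" if "E \<in> panel x C" "\<delta> E D \<in> B" for E
        using other[OF that(1)] that(2) False by (cases "E = C0") auto
      moreover have "C0 \<in> {E\<in>panel x C. \<delta> E D \<in> B}"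
        using C0(1) \<open>v \<in> B\<close> by (simp add: v_def)
      ultimately have "{E\<in>panel x C. \<delta> E D \<in> B} = {C0}" by blast
      then show ?thesis using rhs by simp
    qed
  next
    case False
    then have xv: "x \<otimes> v \<notin> B" using down by blast
    have "\<delta> E D \<notin> B" if "E \<in> panel x C" for E
      using other[OF that] xv False by (cases "E = C0") (auto simp: v_def)
    then have empty: "{E\<in>panel x C. \<delta> E D \<in> B} = {}" by blast
    have "w \<notin> B" using C0(3) xv False by (auto simp: v_def)
    moreover have "w \<noteq> x \<otimes> u" if "u \<in> B" for u
    proof
      assume "w = x \<otimes> u"
      then have "u = x \<otimes> w" using that Bc xS by auto
      then have "u = v \<or> u = x \<otimes> v" using C0(3) xS vc by (auto simp: v_def)
      then show False using that xv False by auto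
    qed
    ultimately have "\<delta> C D \<notin> B \<union> (\<lambda>w. x \<otimes> w) ` B" by (auto simp: w_def)
    then show ?thesis unfolding empty by simp
  qed
qed

lemma panel_sum_eqI: "(\<And>D. D \<in> R \<Longrightarrow> f D = g D) \<Longrightarrow> panel_sum x f C = panel_sum x g C"
  unfolding panel_sum_def by (rule sum.cong) (auto simp: panel_def)

lemma panel_sum_cong:
  assumes "\<And>D. D \<in> R \<Longrightarrow> [f D = g D] (mod int p)"
  shows "[panel_sum x f C = panel_sum x g C] (mod int p)"
  unfolding panel_sum_def by (rule cong_sum) (use assms in \<open>simp add: panel_def\<close>)

lemma panel_sums_cong:
  assumes "\<And>D. D \<in> R \<Longrightarrow> [f D = g D] (mod int p)" "C \<in> R"
  shows "[foldr panel_sum us f C = foldr panel_sum us g C] (mod int p)"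
  using assms(2) by (induction us arbitrary: C) (auto intro: assms(1) panel_sum_cong)

text \<open>Modulo \<open>p\<close> a reachable chamber has weight 1, however many galleries of type
  \<open>us\<close> lead to it, as in the 0-Hecke algebra. The induction step exchanges the two sums
  and applies \<open>panel_count\<close>.\<close>

lemma panel_sums_eq:
  assumes "set us \<subseteq> K" "C \<in> R"
  shows "[foldr panel_sum us f C = (\<Sum>D\<in>{D\<in>R. \<delta> C D \<in> subprods us}. f D)] (mod int p)"
  using assms
proof (induction us arbitrary: C)
  case Nil
  have "{D\<in>R. \<delta> C D \<in> subprods []} = {C}"
    using Nil WD1 R_Ch by (auto simp: subprods_Nil)
  then show ?case by simp
next
  case (Cons x us)
  let ?B = "subprods us"
  have us: "set us \<subseteq> S" "x \<in> K" "x \<in> S" using Cons.prems K by auto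
  have sub: "panel x C \<subseteq> R" by (auto simp: panel_def)
  have as_if: "(\<Sum>D\<in>{D\<in>R. P D}. f D) = (\<Sum>D\<in>R. (if P D then 1 else 0) * f D)" for P
    using fin by (auto simp: sum.inter_filter intro!: sum.cong)
  have "[foldr panel_sum (x # us) f C = (\<Sum>E\<in>panel x C. \<Sum>D\<in>{D\<in>R. \<delta> E D \<in> ?B}. f D)] (mod int p)"
    unfolding foldr_Cons o_apply panel_sum_def[of x _ C]
    by (rule cong_sum) (use Cons sub in auto)
  also have "(\<Sum>E\<in>panel x C. \<Sum>D\<in>{D\<in>R. \<delta> E D \<in> ?B}. f D) =
      (\<Sum>D\<in>R. \<Sum>E\<in>panel x C. (if \<delta> E D \<in> ?B then 1 else 0) * f D)"
    unfolding as_if by (rule sum.swap)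
  also have "\<dots> = (\<Sum>D\<in>R. int (card {E\<in>panel x C. \<delta> E D \<in> ?B}) * f D)"
    by (simp add: sum_distrib_right[symmetric] sum.inter_filter[symmetric])
  also have "[\<dots> = (\<Sum>D\<in>R. (if \<delta> C D \<in> subprods (x # us) then 1 else 0) * f D)] (mod int p)"
  proof (intro cong_sum cong_mult cong_refl)
    fix D assume "D \<in> R"
    then show "[int (card {E\<in>panel x C. \<delta> E D \<in> ?B}) = (if \<delta> C D \<in> subprods (x # us) then 1 else 0)]
        (mod int p)"
      unfolding subprods_Cons using us Cons.prems
      by (intro panel_count subprods_carrier subprods_descent) auto
  qed
  finally show ?case unfolding as_if .
qed

text \<open>A product of panel sums is evaluated in two ways on the constant function 1: each factor
  fixes it modulo \<open>p\<close>, while a word with the whole subgroup among its subword values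
  sums over all of \<open>R\<close>.\<close>

lemma card_residue:
  assumes "set us \<subseteq> K" "generate W K \<subseteq> subprods us"
  shows "[int (card R) = 1] (mod int p)"
proof -
  obtain C where C: "C \<in> R" using residue_nonempty R by blast
  have one: "[foldr panel_sum us (\<lambda>_. 1) C = 1] (mod int p)" if "C \<in> R" for C
    using that assms(1)
  proof (induction us arbitrary: C)
    case (Cons x us)
    have "[foldr panel_sum (x # us) (\<lambda>_. 1) C = panel_sum x (\<lambda>_. 1) C] (mod int p)"
      using Cons by (auto intro: panel_sum_cong)
    also have "[panel_sum x (\<lambda>_. 1) C = 1] (mod int p)"
      using panel_card[of x C] Cons.prems by (simp add: panel_sum_def panel_def)
    finally show ?case .
  qed simp
  have "{D\<in>R. \<delta> C D \<in> subprods us} = R" using residue_\<delta>[OF K R C] assms(2) by auto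
  then have "[foldr panel_sum us (\<lambda>_. 1) C = int (card R)] (mod int p)"
    using panel_sums_eq[OF assms(1) C, of "\<lambda>_. 1"] by simp
  then show ?thesis using one[OF C] cong_trans cong_sym by blast
qed

text \<open>The type of the \<open>n\<close>-th power of an operator that applies panel sums of type
  \<open>us\<close> and then composes with a permutation. Collecting the permutations on one side
  applies \<open>\<sigma>\<close> to the types they pass, so the blocks carry increasing powers of
  \<open>\<sigma>\<close> from right to left.\<close>

fun twisted_power :: "('a \<Rightarrow> 'a) \<Rightarrow> 'a list \<Rightarrow> nat \<Rightarrow> 'a list" where
  "twisted_power \<sigma> us 0 = []"
| "twisted_power \<sigma> us (Suc n) = map (\<sigma> ^^ n) us @ twisted_power \<sigma> us n"

lemma twisted_power_mono: "m \<le> n \<Longrightarrow> subseq (twisted_power \<sigma> us m) (twisted_power \<sigma> us n)"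
proof (induction n rule: dec_induct)
  case (step n)
  then show ?case by (auto intro: subseq_order.trans)
qed simp

lemma twisted_power_K:
  assumes "\<sigma> ` K \<subseteq> K" "set us \<subseteq> K"
  shows "set (twisted_power \<sigma> us n) \<subseteq> K"
proof -
  have "(\<sigma> ^^ n) x \<in> K" if "x \<in> K" for n x using assms(1) that by (induction n) auto
  then show ?thesis using assms(2) by (induction n) auto
qed

text \<open>Two consecutive blocks carry \<open>us\<close> and its image under
  \<open>\<sigma>\<close> and so contain every letter of \<open>K\<close>. Hence the factor 2: each
  letter of \<open>vs\<close> is found in its own pair of blocks.\<close>

lemma twisted_power_subseq:
  assumes "\<And>x. x \<in> K \<Longrightarrow> \<sigma> (\<sigma> x) = x" "set us \<subseteq> K" "K \<subseteq> set us \<union> \<sigma> ` set us" "\<sigma> ` K \<subseteq> K"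
    and "set vs \<subseteq> K"
  shows "subseq vs (twisted_power \<sigma> us (2 * length vs))"
  using assms(5)
proof (induction vs)
  case (Cons x vs)
  let ?k = "2 * length vs"
  have ev: "(\<sigma> ^^ (2 * k)) y = y" if "y \<in> K" for y and k :: nat
    using that assms(1) by (induction k) auto
  have x: "x \<in> K" using Cons.prems by simp
  have "x \<in> set (map (\<sigma> ^^ Suc ?k) us @ map (\<sigma> ^^ ?k) us)"
  proof (cases "x \<in> set us")
    case True
    then show ?thesis using ev[OF x, of "length vs"] by (metis Un_iff imageI set_append set_map)
  next
    case False
    then obtain y where y: "y \<in> set us" "x = \<sigma> y" using assms(3) x by blast
    then have "(\<sigma> ^^ Suc ?k) y = x" using ev[of y "length vs"] assms(2) by auto
    then show ?thesis using y by (metis Un_iff imageI set_append set_map)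
  qed
  then have "subseq [x] (map (\<sigma> ^^ Suc ?k) us @ map (\<sigma> ^^ ?k) us)"
    by (simp only: subseq_singleton_left)
  then have "subseq ([x] @ vs) ((map (\<sigma> ^^ Suc ?k) us @ map (\<sigma> ^^ ?k) us) @ twisted_power \<sigma> us ?k)"
    using Cons by (intro list_emb_append_mono) auto
  then show ?case by simp
qed simp

theorem no_far_automorphism:
  assumes bij: "bij_betw \<rho> R R"
    and \<sigma>: "\<And>C D x. \<lbrakk>C \<in> R; D \<in> R; x \<in> K\<rbrakk> \<Longrightarrow> \<delta> (\<rho> C) (\<rho> D) = \<sigma> x \<longleftrightarrow> \<delta> C D = x"
    and \<sigma>K: "\<sigma> ` K \<subseteq> K" and \<sigma>\<sigma>: "\<And>x. x \<in> K \<Longrightarrow> \<sigma> (\<sigma> x) = x"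
    and us: "set us \<subseteq> K" "K \<subseteq> set us \<union> \<sigma> ` set us"
    and finK: "finite (generate W K)"
  shows "\<exists>C\<in>R. \<delta> (\<rho> C) C \<in> subprods us"
proof (rule ccontr)
  assume far: "\<not> ?thesis"
  \<comment> \<open>Modulo \<open>p\<close> the adjacency operator of \<open>E\<close> is the
    product of panel sums of type \<open>us\<close> composed with \<open>\<rho>\<close>. By
    \<open>far\<close> the relation has no loops, so the traces of the \<open>p ^ r\<close>-th
    powers vanish modulo \<open>p\<close>.\<close>
  define E where "E C D \<longleftrightarrow> \<delta> (\<rho> C) D \<in> subprods us" for C D
  have \<rho>R: "\<rho> C \<in> R" if "C \<in> R" for C using bij that by (auto simp: bij_betw_def)
  have \<rho>n: "(\<rho> ^^ n) C \<in> R" if "C \<in> R" for n C using that \<rho>R by (induction n) auto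
  have commute1: "panel_sum x (\<lambda>D. f (\<rho> D)) C = panel_sum (\<sigma> x) f (\<rho> C)"
    if "x \<in> K" "C \<in> R" for x f C
  proof -
    have inj: "inj_on \<rho> R" and img: "\<rho> ` R = R" using bij by (auto simp: bij_betw_def)
    have iff: "\<delta> (\<rho> C) (\<rho> D) \<in> {\<one>, \<sigma> x} \<longleftrightarrow> \<delta> C D \<in> {\<one>, x}" if "D \<in> R" for D
      using \<sigma>[of C D x] WD1[of C D] WD1[of "\<rho> C" "\<rho> D"] that \<open>x \<in> K\<close> \<open>C \<in> R\<close> \<rho>R R_Ch
        inj_onD[OF inj, of C D] by auto
    have "panel (\<sigma> x) (\<rho> C) = \<rho> ` panel x C"
    proof (intro equalityI subsetI)
      fix Y assume "Y \<in> panel (\<sigma> x) (\<rho> C)"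
      moreover from this obtain D where "D \<in> R" "Y = \<rho> D" using img by (auto simp: panel_def)
      ultimately show "Y \<in> \<rho> ` panel x C" using iff[of D] by (auto simp: panel_def)
    next
      fix Y assume "Y \<in> \<rho> ` panel x C"
      then obtain D where "D \<in> panel x C" "Y = \<rho> D" by blast
      then show "Y \<in> panel (\<sigma> x) (\<rho> C)" using iff[of D] \<rho>R by (simp add: panel_def)
    qed
    moreover have "inj_on \<rho> (panel x C)" using inj by (auto simp: panel_def inj_on_def)
    ultimately show ?thesis by (simp add: panel_sum_def sum.reindex)
  qed
  have \<sigma>n: "(\<sigma> ^^ n) x \<in> K" if "x \<in> K" for n x using \<sigma>K that by (induction n) auto
  have commute_n: "panel_sum x (\<lambda>D. f ((\<rho> ^^ n) D)) C = panel_sum ((\<sigma> ^^ n) x) f ((\<rho> ^^ n) C)"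
    if "x \<in> K" "C \<in> R" for x f C n
    using that
  proof (induction n arbitrary: f)
    case (Suc n)
    have "panel_sum x (\<lambda>D. f ((\<rho> ^^ Suc n) D)) C = panel_sum ((\<sigma> ^^ n) x) (\<lambda>D. f (\<rho> D)) ((\<rho> ^^ n) C)"
      using Suc.IH[of "\<lambda>D. f (\<rho> D)"] Suc.prems by simp
    then show ?case using commute1[of "(\<sigma> ^^ n) x" "(\<rho> ^^ n) C" f] \<sigma>n \<rho>n Suc.prems by simp
  qed simp
  have commute: "foldr panel_sum ws (\<lambda>D. f ((\<rho> ^^ n) D)) C =
      foldr panel_sum (map (\<sigma> ^^ n) ws) f ((\<rho> ^^ n) C)"
    if "set ws \<subseteq> K" "C \<in> R" for ws f C n
    using that
  proof (induction ws arbitrary: C)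
    case (Cons x ws)
    have "foldr panel_sum (x # ws) (\<lambda>D. f ((\<rho> ^^ n) D)) C =
        panel_sum x (\<lambda>C. foldr panel_sum (map (\<sigma> ^^ n) ws) f ((\<rho> ^^ n) C)) C"
      using Cons by (auto intro!: panel_sum_eqI)
    also have "\<dots> = panel_sum ((\<sigma> ^^ n) x) (foldr panel_sum (map (\<sigma> ^^ n) ws) f) ((\<rho> ^^ n) C)"
      using commute_n[of x C "foldr panel_sum (map (\<sigma> ^^ n) ws) f"] Cons.prems by simp
    finally show ?case by simp
  qed simp
  have power: "[(transfer E R ^^ n) f C = foldr panel_sum (twisted_power \<sigma> us n) f ((\<rho> ^^ n) C)]
      (mod int p)" if "C \<in> R" for n f C
    using that
  proof (induction n arbitrary: C)
    case (Suc n)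
    let ?g = "foldr panel_sum (twisted_power \<sigma> us n) f"
    have "[(transfer E R ^^ Suc n) f C = foldr panel_sum us ((transfer E R ^^ n) f) (\<rho> C)] (mod int p)"
      using panel_sums_eq[OF us(1) \<rho>R[OF Suc.prems], of "(transfer E R ^^ n) f"]
      by (simp add: transfer_def E_def cong_sym)
    also have "[foldr panel_sum us ((transfer E R ^^ n) f) (\<rho> C) =
        foldr panel_sum us (\<lambda>D. ?g ((\<rho> ^^ n) D)) (\<rho> C)] (mod int p)"
      by (rule panel_sums_cong) (use Suc \<rho>R in auto)
    also have "foldr panel_sum us (\<lambda>D. ?g ((\<rho> ^^ n) D)) (\<rho> C) =
        foldr panel_sum (map (\<sigma> ^^ n) us) ?g ((\<rho> ^^ Suc n) C)"
      using commute[OF us(1) \<rho>R[OF Suc.prems]] by (simp add: funpow_swap1)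
    finally show ?case by simp
  qed simp
  define k where "k = Max (len ` generate W K)"
  have full: "generate W K \<subseteq> subprods (twisted_power \<sigma> us n)" if "2 * k \<le> n" for n
  proof
    fix w assume w: "w \<in> generate W K"
    then obtain vs where vs: "set vs \<subseteq> K" "wp vs = w" "length vs = len w"
      using reduced_word_in[OF K w] by blast
    have "len w \<le> k" using w finK by (simp add: k_def)
    then have "subseq (twisted_power \<sigma> us (2 * length vs)) (twisted_power \<sigma> us n)"
      using that vs by (intro twisted_power_mono) simp
    moreover have "subseq vs (twisted_power \<sigma> us (2 * length vs))"
      using twisted_power_subseq[OF \<sigma>\<sigma> us \<sigma>K vs(1)] by simp
    ultimately have "subseq vs (twisted_power \<sigma> us n)" using subseq_order.trans by blast
    then show "w \<in> subprods (twisted_power \<sigma> us n)" using vs by (auto simp: subprods_def)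
  qed
  \<comment> \<open>Any power of \<open>p\<close> that is at least \<open>2 * k\<close> would do:
    \<open>k\<close> bounds the lengths in the subgroup, and each letter takes two blocks.\<close>
  define n where "n = p ^ (2 * k)"
  have "2 * k < 2 ^ (2 * k)" by (rule less_exp)
  also have "\<dots> \<le> n" unfolding n_def using prime_ge_2_nat[OF p] by (intro power_mono) auto
  finally have kn: "2 * k \<le> n" by simp
  let ?ws = "twisted_power \<sigma> us n"
  have wsK: "set ?ws \<subseteq> K" using twisted_power_K \<sigma>K us by blast
  have trace: "[(transfer E R ^^ n) (\<lambda>z. if z = C then 1 else 0) C = 1] (mod int p)" if "C \<in> R" for C
  proof -
    \<comment> \<open>The whole subgroup occurs among the subword values, so the sum runs over all
      of \<open>R\<close> wherever \<open>\<rho> ^^ n\<close> sends \<open>C\<close>: every diagonal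
      entry is 1.\<close>
    have "{D\<in>R. \<delta> ((\<rho> ^^ n) C) D \<in> subprods ?ws} = R"
      using full[OF kn] residue_\<delta>[OF K R \<rho>n[OF that, of n]] by auto
    then have "[foldr panel_sum ?ws (\<lambda>z. if z = C then 1 else 0) ((\<rho> ^^ n) C) =
        (\<Sum>D\<in>R. if D = C then 1 else 0)] (mod int p)"
      using panel_sums_eq[OF wsK \<rho>n[OF that, of n], of "\<lambda>z. if z = C then 1 else 0"] by simp
    also have "(\<Sum>D\<in>R. if D = C then 1 else 0) = (1::int)" using that fin by simp
    finally show ?thesis using power[OF that] cong_trans by blast
  qed
  have "[(\<Sum>C\<in>R. (transfer E R ^^ n) (\<lambda>z. if z = C then 1 else 0) C) = (\<Sum>C\<in>R. 1)] (mod int p)"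
    using trace by (intro cong_sum)
  then have "[(\<Sum>C\<in>R. (transfer E R ^^ n) (\<lambda>z. if z = C then 1 else 0) C) = 1] (mod int p)"
    using card_residue[OF wsK full[OF kn]] cong_trans by auto
  moreover have "int p dvd (\<Sum>C\<in>R. (transfer E R ^^ n) (\<lambda>z. if z = C then 1 else 0) C)"
    unfolding n_def using p fin far by (intro prime_dvd_trace_transfer) (auto simp: E_def)
  ultimately have "int p dvd 1" using cong_dvd_iff by blast
  then show False using prime_ge_2_nat[OF p] by simp
qed

end

section \<open>Twin buildings\<close>

lemma opp_opp [simp]: "opp_sign (opp_sign \<epsilon>) = \<epsilon>"
  by (cases \<epsilon>) auto

context twin_building
begin

sublocale half: building W S "Ch \<epsilon>" \<delta> for \<epsilon>
  by (rule halves)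

lemma Ch_sign_unique: "\<lbrakk>C \<in> Ch \<epsilon>; C \<in> Ch \<epsilon>'\<rbrakk> \<Longrightarrow> \<epsilon> = \<epsilon>'"
  using disjoint by (cases \<epsilon>; cases \<epsilon>') auto

text \<open>\<open>Tw2\<close> covers only decreasing steps. In the increasing case
  \<open>Tw3\<close> provides one neighbour \<open>Y\<close> at codistance
  \<open>s \<otimes> cod C D\<close>, and any other neighbour in the panel is reached from
  \<open>Y\<close> by a decreasing step, which leads back to \<open>cod C D\<close>.\<close>

lemma cod_left:
  assumes "C \<in> Ch \<epsilon>" "C' \<in> Ch \<epsilon>" "D \<in> Ch (opp_sign \<epsilon>)" "s \<in> S" "\<delta> C' C = s"
  shows "cod C' D \<in> {cod C D, s \<otimes> cod C D}"
proof -
  have c: "cod C D \<in> carrier W" using cod_closed assms by blast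
  with \<open>s \<in> S\<close> show ?thesis
  proof (cases rule: len_cases)
    case 1
    obtain Y where Y: "Y \<in> Ch \<epsilon>" "\<delta> Y C = s" "cod Y D = s \<otimes> cod C D"
      using Tw3[of C \<epsilon> D "cod C D" s] assms by blast
    show ?thesis
    proof (cases "C' = Y")
      case False
      have "\<delta> C Y = s" using half.\<delta>_sym_S[of Y \<epsilon> C s] Y assms by simp
      then have "\<delta> C' Y \<in> {\<one>, s}" using half.\<delta>_panel[of C' \<epsilon> C Y s] Y assms by simp
      then have "\<delta> C' Y = s" using half.WD1[of C' \<epsilon> Y] Y assms False by simp
      then have "cod C' D = s \<otimes> (s \<otimes> cod C D)"
        using Tw2[of Y \<epsilon> C' D "s \<otimes> cod C D" s] Y assms 1 c by simp
      then show ?thesis using c assms by simp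
    qed (use Y in simp)
  next
    case 2
    then show ?thesis using Tw2[of C \<epsilon> C' D "cod C D" s] assms by simp
  qed
qed

lemma cod_generate_left:
  assumes "K \<subseteq> S" "C \<in> Ch \<epsilon>" "C' \<in> Ch \<epsilon>" "D \<in> Ch (opp_sign \<epsilon>)" "\<delta> C' C \<in> generate W K"
  obtains v where "v \<in> generate W K" "cod C' D = v \<otimes> cod C D"
proof -
  have c: "cod C D \<in> carrier W" using cod_closed assms by blast
  have "\<exists>v\<in>generate W K. cod C' D = v \<otimes> cod C D"
    using assms(1,3,2,5)
  proof (induction rule: half.residue_induct)
    case base
    show ?case using c by (intro bexI[of _ \<one>]) (auto intro: generate.one)
  next
    case (step X Y s)
    then obtain v where v: "v \<in> generate W K" "cod Y D = v \<otimes> cod C D" by blast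
    have s: "s \<in> generate W K" "s \<in> S" using step assms generate.incl by auto
    have "cod X D \<in> {cod Y D, s \<otimes> cod Y D}" using cod_left[of Y \<epsilon> X D s] step s assms by simp
    moreover have "s \<otimes> cod Y D = (s \<otimes> v) \<otimes> cod C D"
      using v s c generate_carrier[OF assms(1)] by (simp add: m_assoc)
    ultimately show ?case using v generate.eng[OF s(1) v(1)] by auto
  qed
  then show thesis using that by blast
qed

lemma cod_generate_right:
  assumes "K \<subseteq> S" "C \<in> Ch \<epsilon>" "D \<in> Ch (opp_sign \<epsilon>)" "D' \<in> Ch (opp_sign \<epsilon>)" "\<delta> D' D \<in> generate W K"
  obtains v where "v \<in> generate W K" "cod C D' = cod C D \<otimes> v"
proof -
  obtain v where v: "v \<in> generate W K" "cod D' C = v \<otimes> cod D C"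
    using cod_generate_left[of K D "opp_sign \<epsilon>" D' C] assms by auto
  have "v \<in> carrier W" "cod D C \<in> carrier W"
    using v generate_carrier assms cod_closed[of D "opp_sign \<epsilon>" C] by auto
  then have "cod C D' = cod C D \<otimes> inv v"
    using Tw1[of C \<epsilon> D] Tw1[of C \<epsilon> D'] v assms by (simp add: inv_mult_group)
  then show thesis using that generate_inv[OF assms(1) v(1)] by blast
qed

lemma cod_right:
  assumes "C \<in> Ch \<epsilon>" "D \<in> Ch (opp_sign \<epsilon>)" "D' \<in> Ch (opp_sign \<epsilon>)" "s \<in> S" "\<delta> D' D = s"
  shows "cod C D' \<in> {cod C D, cod C D \<otimes> s}"
proof -
  have c: "cod C D \<in> carrier W" using cod_closed assms by blast
  have "\<delta> D' D \<in> generate W {s}" using assms by (auto intro: generate.incl)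
  then obtain v where "v \<in> generate W {s}" "cod C D' = cod C D \<otimes> v"
    using cod_generate_right[of "{s}" C \<epsilon> D D'] assms by auto
  then show ?thesis using generate_singleton assms c by auto
qed

lemma cod_surj:
  assumes "K \<subseteq> S" "C \<in> Ch \<epsilon>" "D \<in> Ch (opp_sign \<epsilon>)" "w \<in> generate W K"
  obtains C' where "C' \<in> Ch \<epsilon>" "\<delta> C' C \<in> generate W K" "cod C' D = w \<otimes> cod C D"
proof -
  have c: "cod C D \<in> carrier W" using cod_closed assms by blast
  have "\<exists>C'\<in>Ch \<epsilon>. \<delta> C' C \<in> generate W K \<and> cod C' D = wp us \<otimes> cod C D" if "set us \<subseteq> K" for us
    using that
  proof (induction us)
    case Nil
    show ?case using assms c generate.one by (intro bexI[of _ C]) auto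
  next
    case (Cons s us)
    then obtain Y where Y: "Y \<in> Ch \<epsilon>" "\<delta> Y C \<in> generate W K" "cod Y D = wp us \<otimes> cod C D" by auto
    have s: "s \<in> S" "s \<in> K" "set us \<subseteq> S" using Cons.prems assms by auto
    obtain X where X: "X \<in> Ch \<epsilon>" "\<delta> X Y = s" "cod X D = s \<otimes> (wp us \<otimes> cod C D)"
      using Tw3[of Y \<epsilon> D _ s] Y s assms by blast
    then have "\<delta> X C \<in> generate W K"
      using half.\<delta>_generate_trans[OF assms(1) X(1) Y(1) assms(2)] Y s by (simp add: generate.incl)
    then show ?case using X s c by (intro bexI[of _ X]) (auto simp: m_assoc)
  qed
  moreover obtain us where "set us \<subseteq> K" "wp us = w" using reduced_word_in[OF assms(1,4)] .
  ultimately show thesis using that by blast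
qed

text \<open>\<open>C\<close> is the projection of \<open>D\<close> to the residue: its codistance is
  the longest element, so each step of a minimal gallery away from \<open>C\<close> shortens the
  codistance and \<open>Tw2\<close> determines it.\<close>

lemma cod_longest:
  assumes K: "K \<subseteq> S" and w: "longest K w" and C: "C \<in> Ch \<epsilon>" "C' \<in> Ch \<epsilon>" and D: "D \<in> Ch (opp_sign \<epsilon>)"
    and cod: "cod C D = w" and v: "\<delta> C' C \<in> generate W K"
  shows "cod C' D = \<delta> C' C \<otimes> w"
proof -
  have wc: "w \<in> carrier W" using w generate_carrier[OF K] by (simp add: longest_def)
  have len: "len w = len v + len (v \<otimes> w)" if "v \<in> generate W K" for v
    using longest_factor[OF K w generate_inv[OF K that]] generate_carrier[OF K that] by (simp add: len_inv)
  have "cod C' D = wp us \<otimes> w" if "set us \<subseteq> K" "length us = len (wp us)" "\<delta> C' C = wp us" "C' \<in> Ch \<epsilon>" for us C'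
    using that
  proof (induction us arbitrary: C')
    case Nil
    then have "C' = C" using half.WD1[of C' \<epsilon> C] C by simp
    then show ?case using cod wc by simp
  next
    case (Cons s us)
    have s: "s \<in> K" "s \<in> S" "set us \<subseteq> S" "set us \<subseteq> K" using Cons.prems K by auto
    obtain Y where Y: "Y \<in> Ch \<epsilon>" "\<delta> Y C' = s" "\<delta> Y C = s \<otimes> wp (s # us)"
      using half.WD3[of C' \<epsilon> C s "wp (s # us)"] Cons.prems s C by auto
    then have YC: "\<delta> Y C = wp us" using s by simp
    have red: "length us = len (wp us)"
      using len_le[of us] len_mult_le[of s "wp us"] Cons.prems s by simp
    then have codY: "cod Y D = wp us \<otimes> w" using Cons.IH[of Y] YC Y s by simp
    have "len (s \<otimes> (wp us \<otimes> w)) < len (wp us \<otimes> w)"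
      using len[of "wp us"] len[of "wp (s # us)"] wp_in_generate[OF K, of us]
        wp_in_generate[OF K, of "s # us"] Cons.prems red s wc by (simp add: m_assoc)
    then have "cod C' D = s \<otimes> (wp us \<otimes> w)"
      using Tw2[of Y \<epsilon> C' D "wp us \<otimes> w" s] Y codY Cons.prems s D half.\<delta>_sym_S[of Y \<epsilon> C' s] by simp
    then show ?case using s wc by (simp add: m_assoc)
  qed
  moreover obtain us where "set us \<subseteq> K" "wp us = \<delta> C' C" "length us = len (\<delta> C' C)"
    using reduced_word_in[OF K v] .
  ultimately show ?thesis using C by metis
qed

end

section \<open>Automorphisms exchanging the two halves\<close>

locale twin_exchange = twin_building +
  fixes \<theta>
  assumes \<theta>_half: "C \<in> Ch \<epsilon> \<Longrightarrow> \<theta> C \<in> Ch (opp_sign \<epsilon>)"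
    and \<theta>_inj: "\<lbrakk>C \<in> Ch \<epsilon>; D \<in> Ch \<epsilon>; \<theta> C = \<theta> D\<rbrakk> \<Longrightarrow> C = D"
    and \<theta>_adj: "\<lbrakk>C \<in> Ch \<epsilon>; D \<in> Ch \<epsilon>\<rbrakk> \<Longrightarrow> \<delta> (\<theta> C) (\<theta> D) \<in> S \<longleftrightarrow> \<delta> C D \<in> S"
begin

text \<open>If the two types differed, the images of \<open>C'\<close> and \<open>C''\<close> would
  be at distance a product of two distinct generators, which is not in \<open>S\<close>, whereas
  chambers of one panel are adjacent or equal.\<close>

lemma \<theta>_panel_type:
  assumes C: "C \<in> Ch \<epsilon>" "C' \<in> Ch \<epsilon>" "C'' \<in> Ch \<epsilon>" and s: "s \<in> S" "\<delta> C' C = s" "\<delta> C'' C = s"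
  shows "\<delta> (\<theta> C'') (\<theta> C) = \<delta> (\<theta> C') (\<theta> C)"
proof (rule ccontr)
  assume ne: "\<delta> (\<theta> C'') (\<theta> C) \<noteq> \<delta> (\<theta> C') (\<theta> C)"
  define t where "t = \<delta> (\<theta> C') (\<theta> C)"
  have h: "\<theta> C \<in> Ch (opp_sign \<epsilon>)" "\<theta> C' \<in> Ch (opp_sign \<epsilon>)" "\<theta> C'' \<in> Ch (opp_sign \<epsilon>)"
    using C \<theta>_half by auto
  have t: "t \<in> S" "\<delta> (\<theta> C'') (\<theta> C) \<in> S" using \<theta>_adj C s by (auto simp: t_def)
  then have "\<delta> (\<theta> C) (\<theta> C') = t" using half.\<delta>_sym_S[OF h(2,1)] t_def by simp
  then have "\<delta> (\<theta> C'') (\<theta> C') = \<delta> (\<theta> C'') (\<theta> C) \<otimes> t"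
    using half.\<delta>_two[OF h(3,1,2) refl] t ne by (simp add: t_def)
  then have "\<delta> (\<theta> C'') (\<theta> C') \<notin> S" using S_mult_notin t ne t_def by simp
  then have "\<delta> C'' C' \<notin> S" using \<theta>_adj C by blast
  moreover have "\<delta> C C' = s" using half.\<delta>_sym_S[OF C(2,1) s(2,1)] .
  then have "\<delta> C'' C' \<in> {\<one>, s}" using half.\<delta>_panel[OF C(3,1,2) s(1)] s by simp
  ultimately have "\<delta> C'' C' = \<one>" using s by auto
  then have "C'' = C'" using half.WD1[OF C(3,2)] by simp
  then show False using ne by simp
qed

section \<open>Displacements of chambers\<close>

definition displaced_in :: "'a set \<Rightarrow> bool" where
  "displaced_in K \<longleftrightarrow> (\<forall>\<epsilon>. \<forall>C\<in>Ch \<epsilon>. cod C (\<theta> C) \<in> generate W K)"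

text \<open>\<open>Tw3\<close> yields a neighbour \<open>C'\<close> whose codistance to
  \<open>\<theta> C\<close> is \<open>s \<otimes> w\<close>, outside the subgroup. Passing on to
  \<open>\<theta> C'\<close> must lead back into it, so the new displacement is
  \<open>s \<otimes> w \<otimes> t\<close> and \<open>twisted_conjugate_in\<close> applies.\<close>

lemma displacement_commutes:
  assumes K: "K \<subseteq> S" and disp: "displaced_in K" and s: "s \<in> S - K" and C: "C \<in> Ch \<epsilon>"
  shows "s \<otimes> cod C (\<theta> C) = cod C (\<theta> C) \<otimes> s"
    and "\<exists>C'\<in>Ch \<epsilon>. \<delta> C' C = s \<and> \<delta> (\<theta> C') (\<theta> C) = s"
proof -
  define w where "w = cod C (\<theta> C)"
  have w: "w \<in> generate W K" using disp C by (auto simp: displaced_in_def w_def)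
  have wc: "w \<in> carrier W" using w generate_carrier[OF K] by simp
  obtain C' where C': "C' \<in> Ch \<epsilon>" "\<delta> C' C = s" "cod C' (\<theta> C) = s \<otimes> w"
    using Tw3[of C \<epsilon> "\<theta> C" w s] C \<theta>_half s by (auto simp: w_def)
  define t where "t = \<delta> (\<theta> C') (\<theta> C)"
  have t: "t \<in> S" using \<theta>_adj[OF C'(1) C] C' s by (simp add: t_def)
  have "cod C' (\<theta> C') \<in> {s \<otimes> w, s \<otimes> w \<otimes> t}"
    using cod_right[OF C'(1) \<theta>_half[OF C] \<theta>_half[OF C'(1)] t t_def[symmetric]] C'(3) by simp
  moreover have "cod C' (\<theta> C') \<in> generate W K" using disp C' by (auto simp: displaced_in_def)
  moreover have "s \<otimes> w \<notin> generate W K"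
  proof
    assume "s \<otimes> w \<in> generate W K"
    then have "s \<in> generate W K" using generate_cancel_right[OF K w] s by simp
    then show False using S_in_generate[OF K, of s] s by simp
  qed
  ultimately have "s \<otimes> w \<otimes> t \<in> generate W K" by auto
  then have "t = s \<and> s \<otimes> w = w \<otimes> s" using twisted_conjugate_in[OF K s t w] by blast
  then show "s \<otimes> cod C (\<theta> C) = cod C (\<theta> C) \<otimes> s"
    and "\<exists>C'\<in>Ch \<epsilon>. \<delta> C' C = s \<and> \<delta> (\<theta> C') (\<theta> C) = s"
    using C' by (auto simp: w_def t_def)
qed

lemma displacement_trivial:
  assumes "finite S" "irreducible_coxeter W S" "K \<subseteq> S" "K \<noteq> S" "displaced_in K"
  shows "displaced_in {}"
proof -
  let ?A = "\<lambda>K. K \<subseteq> S \<and> K \<noteq> S \<and> displaced_in K"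
  obtain L where L: "?A L" and min: "\<And>M. ?A M \<Longrightarrow> card L \<le> card M"
    using ex_has_least_nat[of ?A K card] assms by blast
  \<comment> \<open>By \<open>commuting_letters\<close> every displacement is a word in letters of
    \<open>L\<close> commuting with all of \<open>S - L\<close>. Minimality of \<open>L\<close>
    makes these letters all of \<open>L\<close>, so \<open>S\<close> splits into \<open>L\<close>
    and \<open>S - L\<close>.\<close>
  define M where "M = {u\<in>L. \<forall>s\<in>S - L. cox_m W s u = 2}"
  have LS: "L \<subseteq> S" using L by blast
  have MS: "M \<subseteq> L" "M \<subseteq> S" using LS by (auto simp: M_def)
  have "displaced_in M"
    unfolding displaced_in_def
  proof (intro allI ballI)
    fix \<epsilon> C assume C: "C \<in> Ch \<epsilon>"
    let ?w = "cod C (\<theta> C)"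
    have "?w \<in> generate W L" using L C by (auto simp: displaced_in_def)
    then obtain us where us: "set us \<subseteq> L" "wp us = ?w" "length us = len ?w"
      using reduced_word_in[OF LS] by blast
    have "cox_m W s u = 2" if "s \<in> S - L" "u \<in> set us" for s u
    proof -
      have "s \<otimes> ?w = ?w \<otimes> s" using displacement_commutes(1)[OF LS _ that(1) C] L by blast
      then have "s \<otimes> u = u \<otimes> s" using commuting_letters[OF LS that(1) us(1)] us that(2) by simp
      then show ?thesis using cox_m_commute[of s u] that us LS by blast
    qed
    then have "set us \<subseteq> M" using us by (auto simp: M_def)
    then show "?w \<in> generate W M" using wp_in_generate[OF MS(2)] us by metis
  qed
  then have "card L \<le> card M" using min[of M] MS L by blast
  moreover have "finite L" using assms LS finite_subset by blast
  ultimately have "M = L" using MS card_seteq by blast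
  then have "\<forall>s\<in>S - L. \<forall>u\<in>L. cox_m W s u = 2" by (auto simp: M_def)
  moreover have "S - L \<noteq> {}" "(S - L) \<union> L = S" "(S - L) \<inter> L = {}" using L by auto
  ultimately have "L \<noteq> {} \<Longrightarrow> \<not> irreducible_coxeter W S"
    unfolding irreducible_coxeter_def not_not by (intro exI[of _ "S - L"] exI[of _ L] conjI)
  then have "L = {}" using assms(2) by blast
  then show ?thesis using L by simp
qed

lemma displaced_in_empty: "\<lbrakk>displaced_in {}; C \<in> Ch \<epsilon>\<rbrakk> \<Longrightarrow> cod C (\<theta> C) = \<one>"
  using generate_empty unfolding displaced_in_def by blast

text \<open>Every generator lies outside the empty set, so \<open>displacement_commutes\<close>
  gives in each panel one neighbour whose type is kept; \<open>\<theta>_panel_type\<close> extends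
  this to the whole panel.\<close>

lemma displaced_in_empty_type:
  assumes disp: "displaced_in {}" and C: "C \<in> Ch \<epsilon>" "D \<in> Ch \<epsilon>" and s: "s \<in> S"
  shows "\<delta> (\<theta> C) (\<theta> D) = s \<longleftrightarrow> \<delta> C D = s"
proof -
  have *: "\<delta> (\<theta> C) (\<theta> D) = t" if "t \<in> S" "\<delta> C D = t" for t
  proof -
    obtain D' where "D' \<in> Ch \<epsilon>" "\<delta> D' D = t" "\<delta> (\<theta> D') (\<theta> D) = t"
      using displacement_commutes(2)[OF _ disp _ C(2), of t] \<open>t \<in> S\<close> by auto
    then show ?thesis using \<theta>_panel_type[of D \<epsilon> D' C t] C that by simp
  qed
  then show ?thesis using \<theta>_adj[OF C] s by metis
qed

text \<open>Both generators are left descents of \<open>w\<close>, and none of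
  \<open>\<one>\<close>, \<open>a\<close>, \<open>b\<close>, \<open>a \<otimes> b\<close> has both.
  For \<open>a \<otimes> b\<close> this uses \<open>m(a,b) \<ge> 3\<close>: if
  \<open>m(a,b) = 2\<close>, it is the longest element.\<close>

lemma longest_notin_subprods:
  assumes ab: "a \<in> S" "b \<in> S" "a \<noteq> b" "cox_m W a b \<ge> 3" and w: "longest {a, b} w"
  shows "w \<notin> subprods [a, b]"
proof
  assume "w \<in> subprods [a, b]"
  then consider "w = \<one>" | "w = a" | "w = b" | "w = a \<otimes> b"
    using ab by (auto simp: subprods_Cons subprods_Nil)
  moreover have d: "len (a \<otimes> w) < len w" "len (b \<otimes> w) < len w"
    using longest_descent[OF _ w] ab by auto
  ultimately show False
  proof cases
    case 2
    then have "b \<otimes> a = \<one>" using d ab len_0_iff[of "b \<otimes> a"] by simp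
    then show ?thesis using S_mult_one[of b a] ab by simp
  next
    case 3
    then have "a \<otimes> b = \<one>" using d ab len_0_iff[of "a \<otimes> b"] by simp
    then show ?thesis using S_mult_one[of a b] ab by simp
  next
    case 4
    then have "len (b \<otimes> wp [a, b]) < len (wp [a, b])" using d ab by simp
    then obtain xs y ys where e: "[a, b] = xs @ y # ys" "b \<otimes> wp [a, b] = wp (xs @ ys)"
      using exchange[of b "[a, b]"] ab by auto
    then have "wp (xs @ ys) \<in> {a, b}" using ab by (auto simp: Cons_eq_append_conv)
    then have "b \<otimes> wp [a, b] \<in> {a, b}" using e(2) by (simp only:)
    then have "b \<otimes> (a \<otimes> b) \<in> {a, b}" using ab by simp
    then show ?thesis
    proof
      assume "b \<otimes> (a \<otimes> b) = a"
      then have "a \<otimes> b \<otimes> (a \<otimes> b) = \<one>" using ab by (simp add: m_assoc)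
      then have "(a \<otimes> b) [^] (2::nat) = \<one>" using ab by (simp add: numeral_2_eq_2)
      then have "ord (a \<otimes> b) dvd 2" using pow_eq_id[of "a \<otimes> b" 2] ab by simp
      then show False using ab(4) dvd_imp_le[of "ord (a \<otimes> b)" 2] by (simp add: cox_m_def)
    next
      assume "b \<otimes> (a \<otimes> b) \<in> {b}"
      then have "b \<otimes> (b \<otimes> (a \<otimes> b)) = b \<otimes> b" by simp
      then have "a \<otimes> b = \<one>" using ab by simp
      then show False using S_mult_one[of a b] ab by simp
    qed
  qed (use ab in simp)
qed

theorem no_opposite_displacement:
  assumes disp: "displaced_in {}"
    and ab: "a \<in> S" "b \<in> S" "a \<noteq> b" "cox_m W a b \<ge> 3"
    and R: "R \<in> residues_of_type W (Ch \<epsilon>) \<delta> {a, b}" and fin: "finite R" and p: "prime p"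
    and panels: "\<And>x C. \<lbrakk>x \<in> {a, b}; C \<in> R\<rbrakk> \<Longrightarrow>
      [int (card {D\<in>R. \<delta> C D \<in> {\<one>, x}}) = 1] (mod int p)"
  shows False
proof -
  define K where "K = {a, b}"
  have K: "K \<subseteq> S" using ab by (simp add: K_def)
  have RK: "R \<in> residues_of_type W (Ch \<epsilon>) \<delta> K" using R by (simp add: K_def)
  interpret residue_mod_prime W S "Ch \<epsilon>" \<delta> K R p
    by unfold_locales (use K RK fin p panels in \<open>auto simp: K_def\<close>)
  have RCh: "C \<in> Ch \<epsilon>" if "C \<in> R" for C using half.residue_subset RK that by blast
  have RR: "\<delta> C D \<in> generate W K" if "C \<in> R" "D \<in> R" for C D
    using half.residue_\<delta>[OF K RK that] .
  obtain C0 where C0: "C0 \<in> R" using half.residue_nonempty[OF RK] by blast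
  \<comment> \<open>Every element of the subgroup is the distance of some chamber of
    \<open>R\<close> to \<open>C0\<close>, so finiteness passes from \<open>R\<close> to the
    subgroup and a longest element exists.\<close>
  have finK: "finite (generate W K)"
  proof (rule finite_subset)
    show "generate W K \<subseteq> (\<lambda>D. \<delta> D C0) ` R"
    proof
      fix w assume w: "w \<in> generate W K"
      obtain D where D: "D \<in> Ch \<epsilon>" "\<delta> D C0 = w"
        using half.\<delta>_surj[OF RCh[OF C0] generate_carrier[OF K w]] .
      then show "w \<in> (\<lambda>D. \<delta> D C0) ` R"
        using half.residue_closed'[OF K RK C0 D(1)] w by auto
    qed
  qed (use fin in simp)
  obtain w where w: "longest K w" using longest_exists[OF finK] .
  have wK: "w \<in> generate W K" using w by (simp add: longest_def)
  have wc: "w \<in> carrier W" using generate_carrier[OF K wK] .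
  have winv: "inv w = w" using longest_inv[OF K w] .
  have ww: "w \<otimes> w = \<one>" using winv wc r_inv by metis
  have wwx: "w \<otimes> (w \<otimes> x) = x" if "x \<in> carrier W" for x
    using ww wc that by (simp flip: m_assoc)
  have \<theta>R: "\<delta> (\<theta> C) (\<theta> D) \<in> generate W K" if "C \<in> R" "D \<in> R" for C D
    using K RCh[OF that(1)] RCh[OF that(2)] RR[OF that]
  proof (induction rule: half.residue_induct)
    case base
    show ?case using half.\<delta>_self \<theta>_half RCh that generate.one by metis
  next
    case (step X Y s)
    then have "\<delta> (\<theta> X) (\<theta> Y) = s" using displaced_in_empty_type[OF disp step(1,2), of s] K by auto
    then have "\<delta> (\<theta> X) (\<theta> Y) \<in> generate W K" using step generate.incl by metis
    then show ?case
      using half.\<delta>_generate_trans[OF K, of "\<theta> X" "opp_sign \<epsilon>" "\<theta> Y" "\<theta> D"] step \<theta>_half RCh that by blast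
  qed
  \<comment> \<open>This is the projection of \<open>\<theta> D\<close> to \<open>R\<close>, found
    by starting from \<open>D\<close>, which is opposite to \<open>\<theta> D\<close>.\<close>
  have "\<exists>C\<in>R. cod C (\<theta> D) = w" if D: "D \<in> R" for D
  proof -
    obtain C where C: "C \<in> Ch \<epsilon>" "\<delta> C D \<in> generate W K" "cod C (\<theta> D) = w \<otimes> cod D (\<theta> D)"
      using cod_surj[OF K RCh[OF D] \<theta>_half[OF RCh[OF D]] wK] .
    then have "cod C (\<theta> D) = w" using displaced_in_empty[OF disp RCh[OF D]] wc by simp
    then show ?thesis using C half.residue_closed'[OF K RK D C(1)] by blast
  qed
  then obtain \<pi> where \<pi>: "\<And>D. D \<in> R \<Longrightarrow> \<pi> D \<in> R" "\<And>D. D \<in> R \<Longrightarrow> cod (\<pi> D) (\<theta> D) = w"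
    by metis
  text \<open>The codistance from \<open>\<pi> C\<close> to \<open>\<theta> D\<close> is computed in both halves.\<close>
  have rel: "\<delta> (\<pi> C) (\<pi> D) \<otimes> w = w \<otimes> inv (\<delta> (\<theta> D) (\<theta> C))" if C: "C \<in> R" and D: "D \<in> R" for C D
  proof -
    have h: "\<pi> C \<in> Ch \<epsilon>" "\<pi> D \<in> Ch \<epsilon>" "\<theta> C \<in> Ch (opp_sign \<epsilon>)" "\<theta> D \<in> Ch (opp_sign \<epsilon>)"
      using C D \<pi> RCh \<theta>_half by auto
    have "cod (\<pi> C) (\<theta> D) = \<delta> (\<pi> C) (\<pi> D) \<otimes> w"
      using cod_longest[OF K w h(2,1,4) \<pi>(2)[OF D] RR[OF \<pi>(1)[OF C] \<pi>(1)[OF D]]] .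
    moreover have "cod (\<theta> C) (\<pi> C) = w" using Tw1[of "\<theta> C" "opp_sign \<epsilon>" "\<pi> C"] h \<pi>(2)[OF C] winv by simp
    then have "cod (\<theta> D) (\<pi> C) = \<delta> (\<theta> D) (\<theta> C) \<otimes> w"
      using cod_longest[OF K w h(3,4), of "\<pi> C"] h(1) \<theta>R[OF D C] by simp
    then have "cod (\<pi> C) (\<theta> D) = inv (\<delta> (\<theta> D) (\<theta> C) \<otimes> w)"
      using Tw1[of "\<pi> C" \<epsilon> "\<theta> D"] h by simp
    moreover have "\<delta> (\<theta> D) (\<theta> C) \<in> carrier W" using half.\<delta>_closed[OF h(4,3)] .
    ultimately show ?thesis using winv wc by (simp add: inv_mult_group)
  qed
  have "inj_on \<pi> R"
  proof (rule inj_onI)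
    fix C D assume CD: "C \<in> R" "D \<in> R" "\<pi> C = \<pi> D"
    have h: "\<theta> C \<in> Ch (opp_sign \<epsilon>)" "\<theta> D \<in> Ch (opp_sign \<epsilon>)" using CD RCh \<theta>_half by auto
    have c: "\<delta> (\<theta> D) (\<theta> C) \<in> carrier W" using half.\<delta>_closed[OF h(2,1)] .
    have "w = w \<otimes> inv (\<delta> (\<theta> D) (\<theta> C))"
      using rel[OF CD(1,2)] CD(3) half.\<delta>_self[OF RCh[OF \<pi>(1)[OF CD(2)]]] wc by simp
    then have "inv (\<delta> (\<theta> D) (\<theta> C)) = \<one>" using wc c by simp
    then have "\<delta> (\<theta> D) (\<theta> C) = \<one>" using c inv_eq_1_iff by blast
    then have "\<theta> D = \<theta> C" using half.WD1[OF h(2,1)] by simp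
    then show "C = D" using \<theta>_inj[OF RCh[OF CD(1)] RCh[OF CD(2)]] by simp
  qed
  moreover have "\<pi> ` R \<subseteq> R" using \<pi> by auto
  ultimately have bij: "bij_betw \<pi> R R" using endo_inj_surj[OF fin] by (simp add: bij_betw_def)
  define \<rho> where "\<rho> = inv_into R \<pi>"
  have \<rho>bij: "bij_betw \<rho> R R" using bij_betw_inv_into[OF bij] by (simp add: \<rho>_def)
  have \<rho>R: "\<rho> C \<in> R" and \<pi>\<rho>: "\<pi> (\<rho> C) = C" if "C \<in> R" for C
    using that bij \<rho>bij by (auto simp: \<rho>_def bij_betw_def f_inv_into_f inv_into_into)
  \<comment> \<open>By \<open>rel\<close> distances are conjugated by \<open>w\<close> up to
    inversion, so \<open>\<rho>\<close> changes types by the opposition involution.\<close>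
  define \<sigma> where "\<sigma> x = w \<otimes> x \<otimes> w" for x
  have \<sigma>K: "\<sigma> x \<in> K" if "x \<in> K" for x using longest_conjugate[OF K w that] by (simp add: \<sigma>_def)
  have \<sigma>\<sigma>: "\<sigma> (\<sigma> x) = x" if "x \<in> K" for x
    using that K wc wwx ww by (auto simp: \<sigma>_def m_assoc)
  have \<sigma>: "\<delta> (\<rho> C) (\<rho> D) = \<sigma> x \<longleftrightarrow> \<delta> C D = x" if C: "C \<in> R" and D: "D \<in> R" and x: "x \<in> K" for C D x
  proof -
    define d where "d = \<delta> (\<theta> (\<rho> D)) (\<theta> (\<rho> C))"
    have xc: "x \<in> carrier W" "\<sigma> x \<in> S" "\<sigma> x \<in> carrier W" using x K \<sigma>K[OF x] by auto
    have h: "\<rho> C \<in> Ch \<epsilon>" "\<rho> D \<in> Ch \<epsilon>" using C D \<rho>R RCh by auto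
    have dc: "d \<in> carrier W" using half.\<delta>_closed[OF \<theta>_half[OF h(2)] \<theta>_half[OF h(1)]] by (simp add: d_def)
    have CDc: "\<delta> C D \<in> carrier W" using half.\<delta>_closed[OF RCh[OF C] RCh[OF D]] .
    have r: "\<delta> C D \<otimes> w = w \<otimes> inv d" using rel[OF \<rho>R[OF C] \<rho>R[OF D]] \<pi>\<rho> C D by (simp add: d_def)
    have "\<delta> (\<rho> C) (\<rho> D) = \<sigma> x \<longleftrightarrow> \<delta> (\<rho> D) (\<rho> C) = \<sigma> x"
      using half.\<delta>_sym_S[OF h _ xc(2)] half.\<delta>_sym_S[OF h(2,1) _ xc(2)] by blast
    also have "\<dots> \<longleftrightarrow> d = \<sigma> x"
      using displaced_in_empty_type[OF disp h(2,1) xc(2)] by (simp add: d_def)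
    also have "\<dots> \<longleftrightarrow> inv d = \<sigma> x" using xc dc by (metis S_inv inv_inv)
    also have "\<dots> \<longleftrightarrow> w \<otimes> inv d = w \<otimes> \<sigma> x" using xc dc wc by simp
    also have "w \<otimes> \<sigma> x = x \<otimes> w" using xc wc wwx by (simp add: \<sigma>_def m_assoc)
    also have "w \<otimes> inv d = x \<otimes> w \<longleftrightarrow> \<delta> C D = x" unfolding r[symmetric] using CDc wc xc by simp
    finally show ?thesis .
  qed
  \<comment> \<open>From \<open>\<theta> (\<rho> C)\<close> the chamber \<open>C\<close> has
    codistance \<open>w\<close> and \<open>\<rho> C\<close> has codistance \<open>\<one>\<close>, so
    their distance is the inverse of \<open>w\<close>, which is \<open>w\<close>.\<close>
  have far: "\<delta> (\<rho> C) C = w" if C: "C \<in> R" for C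
  proof -
    have h: "\<rho> C \<in> Ch \<epsilon>" "C \<in> Ch \<epsilon>" "\<theta> (\<rho> C) \<in> Ch (opp_sign \<epsilon>)" using C \<rho>R RCh \<theta>_half by auto
    have "cod C (\<theta> (\<rho> C)) = w" using \<pi>(2)[OF \<rho>R[OF C]] \<pi>\<rho>[OF C] by simp
    then have "cod (\<rho> C) (\<theta> (\<rho> C)) = \<delta> (\<rho> C) C \<otimes> w"
      using cod_longest[OF K w h(2,1,3) _ RR[OF \<rho>R[OF C] C]] by simp
    then have "\<delta> (\<rho> C) C \<otimes> w = \<one>" using displaced_in_empty[OF disp h(1)] by simp
    then show ?thesis using inv_equality[OF _ wc half.\<delta>_closed[OF h(1,2)]] winv by simp
  qed
  \<comment> \<open>If \<open>\<sigma>\<close> exchanges the letters, the twist supplies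
    \<open>b\<close>; otherwise both are listed. Either way the subword values lie in
    \<open>subprods [a, b]\<close>.\<close>
  define us where "us = (if \<sigma> a = a then [a, b] else [a])"
  have "\<sigma> a \<in> {a, b}" using \<sigma>K[of a] by (simp add: K_def)
  then have us: "set us \<subseteq> K" "K \<subseteq> set us \<union> \<sigma> ` set us" by (auto simp: us_def K_def)
  have "\<sigma> ` K \<subseteq> K" using \<sigma>K by auto
  then obtain C where C: "C \<in> R" "\<delta> (\<rho> C) C \<in> subprods us"
    using no_far_automorphism[OF \<rho>bij \<sigma> _ \<sigma>\<sigma> us finK] by blast
  have "subprods us \<subseteq> subprods [a, b]" by (rule subprods_mono) (simp add: us_def)
  then have "w \<in> subprods [a, b]" using C far[OF C(1)] by auto
  then show False using longest_notin_subprods[OF ab] w by (simp add: K_def)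
qed

end

section \<open>From opposite residues to displacements\<close>

theorem theorem5p1:
  fixes W :: "('w, 'z) monoid_scheme" and S J :: "'w set"
    and Ch :: "sign \<Rightarrow> 'c set" and \<delta> cod :: "'c \<Rightarrow> 'c \<Rightarrow> 'w"
  assumes "finite S"
    and "irreducible_coxeter W S"
    and "twin_building W S Ch \<delta> cod"
    and "\<exists>\<epsilon> K R. K \<subseteq> S \<and> card K = 2 \<and> R \<in> residues_of_type W (Ch \<epsilon>) \<delta> K \<and> non_exotic W K R \<delta>"
    and "J \<subseteq> S" and "J \<noteq> {}"
  shows "\<not> (\<exists>\<theta>. twin_automorphism W S Ch \<delta> cod \<theta> \<and>
            (\<forall>\<epsilon>. \<forall>R \<in> residues_of_type W (Ch \<epsilon>) \<delta> (S - J).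
               opposite_residues W S Ch \<delta> cod R (\<theta> ` R)))"
proof
  assume "\<exists>\<theta>. twin_automorphism W S Ch \<delta> cod \<theta> \<and>
            (\<forall>\<epsilon>. \<forall>R \<in> residues_of_type W (Ch \<epsilon>) \<delta> (S - J).
               opposite_residues W S Ch \<delta> cod R (\<theta> ` R))"
  then obtain \<theta> where aut: "twin_automorphism W S Ch \<delta> cod \<theta>"
    and opp: "\<And>\<epsilon> R. R \<in> residues_of_type W (Ch \<epsilon>) \<delta> (S - J) \<Longrightarrow>
      opposite_residues W S Ch \<delta> cod R (\<theta> ` R)" by blast
  interpret twin_building W S Ch \<delta> cod by (rule assms(3))
  define M where "M = S - J"
  have M: "M \<subseteq> S" "M \<noteq> S" using assms(5,6) by (auto simp: M_def)
  have oppD: "D \<in> Ch (opp_sign \<epsilon>) \<and> cod C D = \<one>\<^bsub>W\<^esub>"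
    if "opposite W Ch cod C D" "C \<in> Ch \<epsilon>" for C D \<epsilon>
    using that Ch_sign_unique unfolding opposite_def by metis
  \<comment> \<open>That \<open>\<theta>\<close> exchanges the halves is drawn from the opposition
    of a residue and its image. The type \<open>L\<close> of the image is so far unrelated to
    \<open>M\<close>.\<close>
  have res: "\<exists>R L. C \<in> R \<and> R \<in> residues_of_type W (Ch \<epsilon>) \<delta> M \<and> L \<subseteq> S \<and>
      \<theta> ` R \<in> residues_of_type W (Ch (opp_sign \<epsilon>)) \<delta> L \<and>
      (\<forall>X\<in>R. \<exists>Y\<in>\<theta> ` R. Y \<in> Ch (opp_sign \<epsilon>) \<and> cod X Y = \<one>\<^bsub>W\<^esub>)"
    if C: "C \<in> Ch \<epsilon>" for C \<epsilon>
  proof -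
    define R where "R = residue_of W (Ch \<epsilon>) \<delta> M C"
    have R: "R \<in> residues_of_type W (Ch \<epsilon>) \<delta> M"
      using C by (simp add: residues_of_type_def R_def)
    have CR: "C \<in> R" using C generate.one[of W M] by (simp add: R_def residue_of_def)
    have RCh: "R \<subseteq> Ch \<epsilon>" using half.residue_subset[OF R] .
    have o: "opposite_residues W S Ch \<delta> cod R (\<theta> ` R)" using opp R by (simp add: M_def)
    then obtain \<epsilon>' K L where L: "L \<subseteq> S" "R \<in> residues_of_type W (Ch \<epsilon>') \<delta> K"
      "\<theta> ` R \<in> residues_of_type W (Ch (opp_sign \<epsilon>')) \<delta> L"
      unfolding opposite_residues_def by blast
    have "C \<in> Ch \<epsilon>'" using half.residue_subset[OF L(2)] CR by blast
    then have "\<epsilon>' = \<epsilon>" using Ch_sign_unique C by blast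
    moreover have "\<exists>Y\<in>\<theta> ` R. Y \<in> Ch (opp_sign \<epsilon>) \<and> cod X Y = \<one>\<^bsub>W\<^esub>" if "X \<in> R" for X
      using o oppD[of X _ \<epsilon>] that RCh unfolding opposite_residues_def by blast
    ultimately show ?thesis using R CR L by blast
  qed
  have \<theta>_half: "\<theta> C \<in> Ch (opp_sign \<epsilon>)" if C: "C \<in> Ch \<epsilon>" for C \<epsilon>
  proof -
    obtain R L where "C \<in> R" "\<theta> ` R \<in> residues_of_type W (Ch (opp_sign \<epsilon>)) \<delta> L"
      using res[OF C] by blast
    then show ?thesis using half.residue_subset[of "\<theta> ` R" "opp_sign \<epsilon>" L] by blast
  qed
  have all: "C \<in> Ch Pos \<union> Ch Neg" if "C \<in> Ch \<epsilon>" for C \<epsilon> using that by (cases \<epsilon>) auto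
  have adj: "adjacent S Ch \<delta> C D \<longleftrightarrow> \<delta> C D \<in> S" if "C \<in> Ch \<epsilon>" "D \<in> Ch \<epsilon>" for C D \<epsilon>
    using that by (auto simp: adjacent_def)
  interpret twin_exchange W S Ch \<delta> cod \<theta>
  proof unfold_locales
    fix C D \<epsilon> assume CD: "C \<in> Ch \<epsilon>" "D \<in> Ch \<epsilon>"
    show "\<delta> (\<theta> C) (\<theta> D) \<in> S \<longleftrightarrow> \<delta> C D \<in> S"
      using aut all[OF CD(1)] all[OF CD(2)] adj[OF CD] adj[OF \<theta>_half[OF CD(1)] \<theta>_half[OF CD(2)]]
      unfolding twin_automorphism_def by blast
    assume "\<theta> C = \<theta> D"
    then show "C = D" using aut all[OF CD(1)] all[OF CD(2)]
      unfolding twin_automorphism_def bij_betw_def inj_on_def by blast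
  qed (rule \<theta>_half)
  have "displaced_in M"
    unfolding displaced_in_def
  proof (intro allI ballI)
    fix \<epsilon> C assume C: "C \<in> Ch \<epsilon>"
    obtain R L where CR: "C \<in> R" and R: "R \<in> residues_of_type W (Ch \<epsilon>) \<delta> M" and L: "L \<subseteq> S"
      and \<theta>R: "\<theta> ` R \<in> residues_of_type W (Ch (opp_sign \<epsilon>)) \<delta> L"
      and opp: "\<And>X. X \<in> R \<Longrightarrow> \<exists>Y\<in>\<theta> ` R. Y \<in> Ch (opp_sign \<epsilon>) \<and> cod X Y = \<one>\<^bsub>W\<^esub>"
      using res[OF C] by blast
    have RCh: "X \<in> Ch \<epsilon>" if "X \<in> R" for X using half.residue_subset[OF R] that by blast
    obtain D where D: "D \<in> \<theta> ` R" "D \<in> Ch (opp_sign \<epsilon>)" "cod C D = \<one>\<^bsub>W\<^esub>" using opp[OF CR] by blast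
    \<comment> \<open>An \<open>s\<close>-neighbour of \<open>C\<close> at codistance
      \<open>s\<close> from \<open>D\<close> stays in \<open>R\<close> for \<open>s \<in> M\<close>;
      it has an opposite in the image residue, and passing there from \<open>D\<close> undoes
      \<open>s\<close> inside the subgroup of \<open>L\<close>.\<close>
    have "M \<subseteq> L"
    proof
      fix s assume s: "s \<in> M"
      then have sS: "s \<in> S" using M by blast
      obtain C' where C': "C' \<in> Ch \<epsilon>" "\<delta> C' C = s" "cod C' D = s"
        using Tw3[OF C D(2,3) sS] sS by auto
      have "C' \<in> R" using half.residue_closed'[OF M(1) R CR C'(1)] C'(2) s by (simp add: generate.incl)
      then obtain D' where D': "D' \<in> \<theta> ` R" "D' \<in> Ch (opp_sign \<epsilon>)" "cod C' D' = \<one>\<^bsub>W\<^esub>" using opp by blast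
      obtain v where v: "v \<in> generate W L" "cod C' D' = cod C' D \<otimes>\<^bsub>W\<^esub> v"
        using cod_generate_right[OF L C'(1) D(2) D'(2) half.residue_\<delta>[OF L \<theta>R D'(1) D(1)]] .
      then have "s \<otimes>\<^bsub>W\<^esub> v \<in> generate W L" using D' C' generate.one[of W L] by simp
      then have "s \<in> generate W L" using generate_cancel_right[OF L v(1)] sS by simp
      then show "s \<in> L" using S_in_generate[OF L sS] by simp
    qed
    \<comment> \<open>Every type in \<open>L\<close> occurs at \<open>\<theta> C\<close> inside the
      image residue and is pulled back to a type in \<open>M\<close> at \<open>C\<close>;
      \<open>\<theta>_panel_type\<close> makes this assignment injective.\<close>
    moreover have "card L \<le> card M"
    proof -
      have "\<exists>X\<in>Ch \<epsilon>. \<delta> (\<theta> X) (\<theta> C) = u \<and> \<delta> X C \<in> M" if u: "u \<in> L" for u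
      proof -
        have uS: "u \<in> S" using u L by blast
        obtain Y where Y: "Y \<in> Ch (opp_sign \<epsilon>)" "\<delta> Y (\<theta> C) = u"
          using half.\<delta>_surj[OF \<theta>_half[OF C]] uS by (metis S_carrier)
        then have "Y \<in> \<theta> ` R"
          using half.residue_closed'[OF L \<theta>R imageI[OF CR] Y(1)] u by (simp add: generate.incl)
        then obtain X where X: "X \<in> R" "Y = \<theta> X" by blast
        have "\<delta> X C \<in> S" using \<theta>_adj[OF RCh[OF X(1)] C] Y X uS by simp
        then have "\<delta> X C \<in> M" using S_in_generate[OF M(1)] half.residue_\<delta>[OF M(1) R X(1) CR] by simp
        then show ?thesis using X Y RCh by blast
      qed
      then obtain g where g: "\<And>u. u \<in> L \<Longrightarrow> g u \<in> Ch \<epsilon>" "\<And>u. u \<in> L \<Longrightarrow> \<delta> (\<theta> (g u)) (\<theta> C) = u"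
        "\<And>u. u \<in> L \<Longrightarrow> \<delta> (g u) C \<in> M" by metis
      have "inj_on (\<lambda>u. \<delta> (g u) C) L"
      proof (rule inj_onI)
        fix u v assume uv: "u \<in> L" "v \<in> L" "\<delta> (g u) C = \<delta> (g v) C"
        then have "\<delta> (\<theta> (g u)) (\<theta> C) = \<delta> (\<theta> (g v)) (\<theta> C)"
          using \<theta>_panel_type[OF C g(1)[OF uv(2)] g(1)[OF uv(1)] _ refl] g(3)[OF uv(2)] M by auto
        then show "u = v" using g(2) uv by simp
      qed
      moreover have "finite M" using finite_subset[OF M(1) assms(1)] .
      ultimately show ?thesis using g(3) by (intro card_inj_on_le) auto
    qed
    ultimately have "M = L" using card_seteq[of L M] finite_subset[OF L assms(1)] by blast
    have "\<delta> (\<theta> C) D \<in> generate W L" using half.residue_\<delta>[OF L \<theta>R imageI[OF CR] D(1)] .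
    then obtain v where "v \<in> generate W L" "cod C (\<theta> C) = cod C D \<otimes>\<^bsub>W\<^esub> v"
      using cod_generate_right[OF L C D(2) \<theta>_half[OF C]] by blast
    then show "cod C (\<theta> C) \<in> generate W M" using D \<open>M = L\<close> generate_carrier[OF L] by simp
  qed
  then have disp: "displaced_in {}" using displacement_trivial assms(1,2) M by blast
  obtain \<epsilon> K R where KR: "K \<subseteq> S" "R \<in> residues_of_type W (Ch \<epsilon>) \<delta> K" "non_exotic W K R \<delta>"
    using assms(4) by blast
  then obtain a b s t where ab: "K = {a, b}" "a \<noteq> b" "cox_m W a b \<ge> 3"
    and par: "has_parameters W R \<delta> a b s t" and gcd: "gcd s t > 1" and fin: "finite R"
    unfolding non_exotic_def by blast
  have abS: "a \<in> S" "b \<in> S" using KR ab by auto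
  obtain p where p: "prime p" "p dvd gcd s t" using prime_factor_nat[of "gcd s t"] gcd by auto
  have "[int (card {D\<in>R. \<delta> C D \<in> {\<one>\<^bsub>W\<^esub>, x}}) = 1] (mod int p)" if x: "x \<in> {a, b}" and C: "C \<in> R" for x C
  proof -
    have "{D\<in>R. \<delta> C D \<in> {\<one>\<^bsub>W\<^esub>, x}} \<in> residues_of_type W R \<delta> {x}"
      using C generate_singleton[of x] x abS by (auto simp: residues_of_type_def residue_of_def)
    then obtain q where "card {D\<in>R. \<delta> C D \<in> {\<one>\<^bsub>W\<^esub>, x}} = q + 1" "q = s \<or> q = t"
      using x par by (auto simp: has_parameters_def)
    moreover have "p dvd s" "p dvd t" using p by auto
    ultimately show ?thesis by (auto simp: cong_iff_dvd_diff)
  qed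
  then show False
    using no_opposite_displacement[OF disp abS ab(2,3) _ fin p(1)] KR(2) ab(1) by blast
qed

end
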